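(* Let $g\in M^1$ and let $\Delta\subset\mathbb{R}^2$ be the union of $N$ disjoint, compact sets $\Delta_1,\dots,\Delta_N$. Put $d:=\min_{k\neq l}\operatorname{dist}(\Delta_k,\Delta_l)$. If $d$ tends to infinity, then $$\sup_{f\in L^2(\mathbb{R})}\frac{\|V_gf\cdot\chi_{\Delta}\|_2}{\|V_gf\|_2}\longrightarrow\max_{k=1,\dots,N}\ \sup_{f\in L^2(\mathbb{R})}\frac{\|V_gf\cdot\chi_{\Delta_k}\|_2}{\|V_gf\|_2}.$$
   Context: For $z=(x,\xi)\in\mathbb{R}^2$ put $\pi(z)g(t)=e^{2\pi i\xi t}g(t-x)$. The short-time Fourier transform of $f\in L^2(\mathbb{R})$ with window $g\in L^2(\mathbb{R})$ is $V_gf(z)=\langle f,\pi(z)g\rangle=\int_{\mathbb{R}}f(t)\overline{g(t-x)}e^{-2\pi i\xi t}dt$. The modulation space $M^1$ is the set of tempered distributions $f$ on $\mathbb{R}$ with $V_\varphi f\in L^1(\mathbb{R}^2)$, where $\varphi(t)=2^{1/4}e^{-\pi t^2}$ (it is contained in $L^2(\mathbb{R})$). For sets $A,B\subset\mathbb{R}^2$, $\operatorname{dist}(A,B)=\inf\{|x-y|:x\in A,\ y\in B\}$. $\chi_\Delta$ is the indicator function of $\Delta$ and $\|\cdot\|_2$ is the norm of $L^2(\mathbb{R}^2)$. *)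

theory Defs
  imports "HOL-Analysis.Analysis"
begin

text \<open>Elements of \<open>L\<^sup>2\<close> are represented by Borel measurable functions; everything below depends
  only on their almost-everywhere classes.\<close>

definition L2 :: "'a measure \<Rightarrow> ('a \<Rightarrow> complex) set" where
  "L2 M = {f \<in> borel_measurable M. integrable M (\<lambda>t. (cmod (f t))\<^sup>2)}"

definition L2_norm :: "'a measure \<Rightarrow> ('a \<Rightarrow> complex) \<Rightarrow> real" where
  "L2_norm M f = sqrt (\<integral>t. (cmod (f t))\<^sup>2 \<partial>M)"

definition L2_inner :: "'a measure \<Rightarrow> ('a \<Rightarrow> complex) \<Rightarrow> ('a \<Rightarrow> complex) \<Rightarrow> complex" where
  "L2_inner M f g = (\<integral>t. f t * cnj (g t) \<partial>M)"

definition tf_shift :: "real \<times> real \<Rightarrow> (real \<Rightarrow> complex) \<Rightarrow> real \<Rightarrow> complex" where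
  "tf_shift = (\<lambda>(x, \<xi>) g t. exp (2 * of_real pi * \<i> * of_real \<xi> * of_real t) * g (t - x))"

definition stft :: "(real \<Rightarrow> complex) \<Rightarrow> (real \<Rightarrow> complex) \<Rightarrow> real \<times> real \<Rightarrow> complex" where
  "stft g f z = L2_inner lborel f (tf_shift z g)"

lemma stft_eq:
  "stft g f (x, \<xi>) =
    (\<integral>t. f t * cnj (g (t - x)) * exp (- 2 * of_real pi * \<i> * of_real \<xi> * of_real t) \<partial>lborel)"
  by (simp add: stft_def L2_inner_def tf_shift_def exp_cnj mult_ac)

definition gaussian :: "real \<Rightarrow> complex" where
  "gaussian t = of_real (2 powr (1/4) * exp (- pi * t\<^sup>2))"

text \<open>The modulation space \<open>M\<^sup>1\<close> is usually cut out of the tempered distributions. As it is contained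
  in \<open>L\<^sup>2\<close>, where the distributional short-time Fourier transform is the integral above, it can be
  cut out of \<open>L\<^sup>2\<close> instead.\<close>

definition M1 :: "(real \<Rightarrow> complex) set" where
  "M1 = {f \<in> L2 lborel. integrable lborel (stft gaussian f)}"

text \<open>By the orthogonality relations \<open>stft g f\<close> lies in \<open>L\<^sup>2\<close>, so the quotients lie in \<open>[0, 1]\<close> and
  the supremum is over a bounded nonempty set of reals. Where \<open>stft g f\<close> vanishes (in particular
  for \<open>f = 0\<close>) the quotient is \<open>0 / 0 = 0\<close>, which does not affect a supremum of nonnegative numbers.\<close>

definition concentration :: "(real \<Rightarrow> complex) \<Rightarrow> (real \<times> real) set \<Rightarrow> real" where
  "concentration g \<Delta> =
    (SUP f\<in>L2 lborel. L2_norm lborel (\<lambda>z. stft g f z * indicator \<Delta> z) / L2_norm lborel (stft g f))"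

text \<open>Extended-real infima, so that the distance to an empty set, and the minimum over the empty set
  of pairs that arises from a single set, are \<open>\<infinity>\<close>; \<^const>\<open>setdist\<close> would give \<open>0\<close> for an empty set.\<close>

definition set_distance :: "'a::metric_space set \<Rightarrow> 'a set \<Rightarrow> ereal" where
  "set_distance A B = (INF x\<in>A. INF y\<in>B. ereal (dist x y))"

definition separation :: "nat \<Rightarrow> (nat \<Rightarrow> 'a::metric_space set) \<Rightarrow> ereal" where
  "separation N \<Delta> = (INF (k, l)\<in>{(k, l). k \<in> {1..N} \<and> l \<in> {1..N} \<and> k \<noteq> l}. set_distance (\<Delta> k) (\<Delta> l))"

end

theory Submission
  imports Defs "HOL-Probability.Characteristic_Functions"
begin

text \<open>The squared concentration of a set \<open>A\<close> is the norm of the operator \<open>\<chi>\<^sub>A P \<chi>\<^sub>A\<close>, where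
\<open>P\<close> projects orthogonally onto the range of \<open>f \<mapsto> stft g f\<close>; this uses Moyal's identity
\<open>\<parallel>stft g f\<parallel> = \<parallel>f\<parallel> \<parallel>g\<parallel>\<close> (lemma \<open>moyal\<close>). If \<open>A\<close> is the union of disjoint sets
\<open>A\<^sub>1, \<dots>, A\<^sub>N\<close>, that operator is a matrix of blocks. The norm of its diagonal part is the largest of
the squared concentrations of the \<open>A\<^sub>k\<close>, and a block off the diagonal has small norm if the sets are
far apart: the kernel of \<open>P\<close> is dominated by a function of \<open>z - w\<close> which is integrable for \<open>g\<close> in
\<open>M1\<close>, so Schur's test bounds the block by the integral of that function outside a large ball. This
bound depends only on the distance, not on the shape or size of the sets, and the concentration of
the union is at least that of each part. Hence the difference tends to \<open>0\<close>.

The argument runs without projections. For \<open>F = stft g f\<close> the pieces \<open>\<chi>\<^bsub>A\<^sub>k\<^esub> F\<close> are sent back to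
functions \<open>h\<^sub>k\<close> on the line by the adjoint of \<open>stft g\<close>, called \<open>synthesis g\<close>. Then the energy of
\<open>F\<close> on the union is the inner product of \<open>\<Sum>h\<^sub>k\<close> with \<open>f\<close>, the norm of each \<open>h\<^sub>k\<close> is controlled by the
concentration of \<open>A\<^sub>k\<close> (lemma \<open>norm_synthesis_restricted_stft_le\<close>), and the \<open>h\<^sub>k\<close> are almost
orthogonal (lemma \<open>norm_sum_synthesis_le\<close>). Almost orthogonality is seen after a second
transform with the Gaussian window \<open>\<phi>\<close>, again isometric up to a constant: the transform of \<open>h\<^sub>k\<close> is
dominated by the convolution of \<open>\<bar>\<chi>\<^bsub>A\<^sub>k\<^esub> F\<bar>\<close> with \<open>m = \<bar>stft \<phi> g\<bar>\<close>, and two such convolutions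
hardly overlap, because the correlation of \<open>m\<close> with itself is integrable (lemmas
\<open>separated_convolutions_almost_orthogonal\<close> and \<open>tail_correlation_tendsto_0\<close>). Lemma
\<open>concentration_separated_UN_le\<close> puts the estimates together.

Moyal's identity is Plancherel's identity in the frequency variable followed by Tonelli's theorem in
the time variable. Plancherel's identity is needed only for functions that are both integrable and
square-integrable. With a Gaussian weight, the energy of the Fourier transform becomes an average of
the autocorrelation of the function near \<open>0\<close>; removing the weight leaves the value at \<open>0\<close>, which is
the energy of the function, because translation is continuous in the mean.\<close>

section \<open>Continuity of translation in the mean\<close>

lemma tendsto_ennreal_0_iff:
  fixes a :: "nat \<Rightarrow> ennreal"
  shows "a \<longlonglongrightarrow> 0 \<longleftrightarrow> (\<forall>e>0. \<forall>\<^sub>F n in sequentially. a n < ennreal e)"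
proof
  assume "a \<longlonglongrightarrow> 0"
  then show "\<forall>e>0. \<forall>\<^sub>F n in sequentially. a n < ennreal e"
    by (auto intro!: order_tendstoD)
next
  assume a: "\<forall>e>0. \<forall>\<^sub>F n in sequentially. a n < ennreal e"
  show "a \<longlonglongrightarrow> 0"
  proof (rule order_tendstoI)
    fix x :: ennreal assume "0 < x"
    then obtain e where "0 < e" "ennreal e \<le> x"
      by (cases x) (auto intro: exI[of _ 1] that[of 1])
    with a[rule_format, of e] show "\<forall>\<^sub>F n in sequentially. a n < x"
      by (auto elim!: eventually_mono)
  qed auto
qed

lemma
  fixes f :: "'a::euclidean_space \<Rightarrow> ennreal"
  assumes [measurable]: "f \<in> borel_measurable borel"
  shows nn_integral_lborel_shift: "(\<integral>\<^sup>+t. f (t + u) \<partial>lborel) = (\<integral>\<^sup>+t. f t \<partial>lborel)"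
    and nn_integral_lborel_reflect: "(\<integral>\<^sup>+t. f (u - t) \<partial>lborel) = (\<integral>\<^sup>+t. f t \<partial>lborel)"
proof -
  have *: "(\<integral>\<^sup>+t. f t \<partial>lborel) = (\<integral>\<^sup>+t. f (u + c *\<^sub>R t) \<partial>lborel)" if "\<bar>c\<bar> = 1" for c
    using that by (subst lborel_affine[of c u]) (auto simp: nn_integral_density nn_integral_distr)
  show "(\<integral>\<^sup>+t. f (t + u) \<partial>lborel) = (\<integral>\<^sup>+t. f t \<partial>lborel)"
    using *[of 1] by (simp add: add.commute)
  show "(\<integral>\<^sup>+t. f (u - t) \<partial>lborel) = (\<integral>\<^sup>+t. f t \<partial>lborel)"
    using *[of "-1"] by simp
qed

text \<open>Translation preserves the distance in the mean, so continuity passes from approximants to their limit.\<close>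

lemma translation_continuous_approx:
  fixes f :: "real \<Rightarrow> 'a::{banach, second_countable_topology}"
  assumes [measurable]: "f \<in> borel_measurable borel"
    and approx: "\<And>e. e > 0 \<Longrightarrow> \<exists>h \<in> borel_measurable borel. (\<integral>\<^sup>+t. norm (f t - h t) \<partial>lborel) < ennreal e \<and>
        (\<lambda>n. \<integral>\<^sup>+t. norm (h (t + v n) - h t) \<partial>lborel) \<longlonglongrightarrow> 0"
  shows "(\<lambda>n. \<integral>\<^sup>+t. norm (f (t + v n) - f t) \<partial>lborel) \<longlonglongrightarrow> 0"
  unfolding tendsto_ennreal_0_iff
proof safe
  fix e :: real assume "e > 0"
  then obtain h where [measurable]: "h \<in> borel_measurable borel"
    and fh: "(\<integral>\<^sup>+t. norm (f t - h t) \<partial>lborel) < ennreal (e / 3)"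
    and h: "(\<lambda>n. \<integral>\<^sup>+t. norm (h (t + v n) - h t) \<partial>lborel) \<longlonglongrightarrow> 0"
    using approx[of "e / 3"] by auto
  have "\<forall>\<^sub>F n in sequentially. (\<integral>\<^sup>+t. norm (h (t + v n) - h t) \<partial>lborel) < ennreal (e / 3)"
    using h \<open>e > 0\<close> by (auto simp: tendsto_ennreal_0_iff)
  then show "\<forall>\<^sub>F n in sequentially. (\<integral>\<^sup>+t. norm (f (t + v n) - f t) \<partial>lborel) < ennreal e"
  proof eventually_elim
    case (elim n)
    have "(\<integral>\<^sup>+t. norm (f (t + v n) - f t) \<partial>lborel) \<le>
      (\<integral>\<^sup>+t. (ennreal (norm (f (t + v n) - h (t + v n))) + ennreal (norm (h (t + v n) - h t))) + norm (f t - h t) \<partial>lborel)"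
    proof (rule nn_integral_mono)
      fix t
      have "norm (f (t + v n) - f t) \<le> (norm (f (t + v n) - h (t + v n)) + norm (h (t + v n) - h t)) + norm (f t - h t)"
        by norm
      then show "ennreal (norm (f (t + v n) - f t)) \<le>
         (ennreal (norm (f (t + v n) - h (t + v n))) + ennreal (norm (h (t + v n) - h t))) + norm (f t - h t)"
        by (simp flip: ennreal_plus)
    qed
    also have "\<dots> = ((\<integral>\<^sup>+t. norm (f (t + v n) - h (t + v n)) \<partial>lborel) + (\<integral>\<^sup>+t. norm (h (t + v n) - h t) \<partial>lborel))
        + (\<integral>\<^sup>+t. norm (f t - h t) \<partial>lborel)"
      by (simp add: nn_integral_add)
    also have "(\<integral>\<^sup>+t. norm (f (t + v n) - h (t + v n)) \<partial>lborel) = (\<integral>\<^sup>+t. norm (f t - h t) \<partial>lborel)"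
      by (rule nn_integral_lborel_shift) simp
    also have "\<dots> + (\<integral>\<^sup>+t. norm (h (t + v n) - h t) \<partial>lborel) + (\<integral>\<^sup>+t. norm (f t - h t) \<partial>lborel)
        < (ennreal (e / 3) + ennreal (e / 3)) + ennreal (e / 3)"
      by (intro add_strict_mono fh elim)
    also have "\<dots> = ennreal e"
      using \<open>e > 0\<close> by (simp flip: ennreal_plus)
    finally show ?case .
  qed
qed

text \<open>As translation preserves the measure of \<open>U\<close>, the part of \<open>U\<close> that is moved out of \<open>U\<close> is as large as
the part that is moved in. The former tends to \<open>0\<close> by dominated convergence, since every point of an
open set stays inside under small translations.\<close>

lemma translation_continuous_open:
  fixes U :: "real set" and v :: "nat \<Rightarrow> real"
  assumes U: "open U" "emeasure lborel U < \<infinity>" and v: "v \<longlonglongrightarrow> 0"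
  shows "(\<lambda>n. \<integral>\<^sup>+t. norm (indicator U (t + v n) - indicator U t :: real) \<partial>lborel) \<longlonglongrightarrow> 0"
proof -
  have [measurable]: "U \<in> sets borel" using U by auto
  define a where "a = (\<lambda>n. \<integral>\<^sup>+t. indicator U t * indicator (- U) (t + v n) \<partial>lborel)"
  define b where "b = (\<lambda>n. \<integral>\<^sup>+t. indicator U (t + v n) * indicator (- U) t \<partial>lborel)"
  define c where "c = (\<lambda>n. \<integral>\<^sup>+t. indicator U t * indicator U (t + v n) \<partial>lborel)"
  have ac: "a n + c n = emeasure lborel U" for n
  proof -
    have "a n + c n = (\<integral>\<^sup>+t. indicator U t * indicator (- U) (t + v n) + indicator U t * indicator U (t + v n) \<partial>lborel)"
      unfolding a_def c_def by (subst nn_integral_add) auto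
    also have "\<dots> = (\<integral>\<^sup>+t. indicator U t \<partial>lborel)"
      by (intro nn_integral_cong) (auto simp: indicator_def)
    finally show ?thesis by simp
  qed
  have bc: "b n + c n = emeasure lborel U" for n
  proof -
    have "b n + c n = (\<integral>\<^sup>+t. indicator U (t + v n) * indicator (- U) t + indicator U t * indicator U (t + v n) \<partial>lborel)"
      unfolding b_def c_def by (subst nn_integral_add) auto
    also have "\<dots> = (\<integral>\<^sup>+t. indicator U (t + v n) \<partial>lborel)"
      by (intro nn_integral_cong) (auto simp: indicator_def)
    also have "\<dots> = (\<integral>\<^sup>+t. indicator U t \<partial>lborel)"
      by (rule nn_integral_lborel_shift) simp
    finally show ?thesis by simp
  qed
  have cfin: "c n \<noteq> \<infinity>" for n
    using ac[of n] U(2) by (metis ennreal_add_eq_top infinity_ennreal_def less_irrefl)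
  \<comment> \<open>The parts \<open>a n\<close> and \<open>b n\<close> complement the common part \<open>c n\<close> to sets of equal finite measure.\<close>
  have ab: "a n = b n" for n
    using ac[of n] bc[of n] cfin[of n] by (metis ennreal_add_left_cancel add.commute infinity_ennreal_def)
  have "a \<longlonglongrightarrow> (\<integral>\<^sup>+t. 0 \<partial>(lborel :: real measure))"
    unfolding a_def
  proof (rule nn_integral_dominated_convergence[where w="indicator U"])
    show "AE t in lborel. (\<lambda>n. indicator U t * indicator (- U) (t + v n) :: ennreal) \<longlonglongrightarrow> 0"
    proof (rule AE_I2)
      fix t
      show "(\<lambda>n. indicator U t * indicator (- U) (t + v n) :: ennreal) \<longlonglongrightarrow> 0"
      proof (cases "t \<in> U")
        case True
        have "(\<lambda>n. t + v n) \<longlonglongrightarrow> t + 0" using v by (intro tendsto_intros)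
        then have "\<forall>\<^sub>F n in sequentially. t + v n \<in> U"
          using U(1) True by (auto dest!: topological_tendstoD)
        then have "\<forall>\<^sub>F n in sequentially. indicator U t * indicator (- U) (t + v n) = (0::ennreal)"
          by eventually_elim auto
        then show ?thesis by (rule tendsto_eventually)
      qed simp
    qed
    show "AE t in lborel. indicator U t * indicator (- U) (t + v n) \<le> (indicator U t :: ennreal)" for n
      by (auto simp: indicator_def)
  qed (use U(2) in auto)
  then have a: "a \<longlonglongrightarrow> 0" by simp
  have "(\<integral>\<^sup>+t. norm (indicator U (t + v n) - indicator U t :: real) \<partial>lborel) = a n + b n" for n
    unfolding a_def b_def
    by (subst nn_integral_add[symmetric]) (auto intro!: nn_integral_cong simp: indicator_def)
  moreover have "(\<lambda>n. a n + b n) \<longlonglongrightarrow> 0 + 0"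
    unfolding ab[symmetric] by (intro tendsto_add a)
  ultimately show ?thesis by simp
qed

lemma translation_continuous_indicator:
  fixes A :: "real set" and v :: "nat \<Rightarrow> real"
  assumes A: "A \<in> sets borel" "emeasure lborel A < \<infinity>" and v: "v \<longlonglongrightarrow> 0"
  shows "(\<lambda>n. \<integral>\<^sup>+t. norm (indicator A (t + v n) - indicator A t :: real) \<partial>lborel) \<longlonglongrightarrow> 0"
proof (rule translation_continuous_approx)
  show "indicator A \<in> borel_measurable (borel :: real measure)" using A by simp
  fix e :: real assume "e > 0"
  obtain U where U: "open U" "A \<subseteq> U" "emeasure lborel (U - A) < ennreal e"
    using outer_regular_lborel[OF A(1) \<open>e > 0\<close>] by blast
  have [measurable]: "U \<in> sets borel" "A \<in> sets borel" using U A by auto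
  have "emeasure lborel U = emeasure lborel A + emeasure lborel (U - A)"
    using U by (subst plus_emeasure) (auto intro!: arg_cong[of _ _ "emeasure lborel"])
  also have "\<dots> < \<infinity>" using U(3) A(2) by (auto intro: less_trans[of _ "ennreal e"])
  finally have "emeasure lborel U < \<infinity>" .
  moreover have "(\<integral>\<^sup>+t. norm (indicator A t - indicator U t :: real) \<partial>lborel) = (\<integral>\<^sup>+t. indicator (U - A) t \<partial>lborel)"
    using U(2) by (intro nn_integral_cong) (auto simp: indicator_def)
  ultimately show "\<exists>h \<in> borel_measurable borel. (\<integral>\<^sup>+t. norm (indicator A t - h t :: real) \<partial>lborel) < ennreal e \<and>
        (\<lambda>n. \<integral>\<^sup>+t. norm (h (t + v n) - h t) \<partial>lborel) \<longlonglongrightarrow> 0"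
    using U by (intro bexI[of _ "indicator U"] conjI translation_continuous_open v) auto
qed

lemma translation_continuous_L1:
  fixes f :: "real \<Rightarrow> 'a::{banach, second_countable_topology}"
  assumes "integrable lborel f" and v: "v \<longlonglongrightarrow> 0"
  shows "(\<lambda>n. \<integral>\<^sup>+t. norm (f (t + v n) - f t) \<partial>lborel) \<longlonglongrightarrow> 0"
  using assms(1)
proof induction
  case (base A c)
  then have [measurable]: "A \<in> sets borel" by simp
  have "(\<integral>\<^sup>+t. norm (indicator A (t + v n) *\<^sub>R c - indicator A t *\<^sub>R c) \<partial>lborel) =
     ennreal (norm c) * (\<integral>\<^sup>+t. norm (indicator A (t + v n) - indicator A t :: real) \<partial>lborel)" for n
    by (subst nn_integral_cmult[symmetric])
       (auto intro!: nn_integral_cong simp: indicator_def simp flip: ennreal_mult)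
  moreover have "(\<lambda>n. ennreal (norm c) * (\<integral>\<^sup>+t. norm (indicator A (t + v n) - indicator A t :: real) \<partial>lborel)) \<longlonglongrightarrow> ennreal (norm c) * 0"
    using base by (intro ennreal_tendsto_cmult translation_continuous_indicator v) auto
  ultimately show ?case by simp
next
  case (add f g)
  have [measurable]: "f \<in> borel_measurable borel" "g \<in> borel_measurable borel"
    using add.hyps by (auto dest: borel_measurable_integrable)
  show ?case
  proof (rule tendsto_sandwich[OF _ _ tendsto_const])
    show "(\<lambda>n. (\<integral>\<^sup>+t. norm (f (t + v n) - f t) \<partial>lborel) + (\<integral>\<^sup>+t. norm (g (t + v n) - g t) \<partial>lborel)) \<longlonglongrightarrow> 0"
      using tendsto_add[OF add.IH] by simp
    show "\<forall>\<^sub>F n in sequentially. (\<integral>\<^sup>+t. norm (f (t + v n) + g (t + v n) - (f t + g t)) \<partial>lborel) \<le>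
       (\<integral>\<^sup>+t. norm (f (t + v n) - f t) \<partial>lborel) + (\<integral>\<^sup>+t. norm (g (t + v n) - g t) \<partial>lborel)"
    proof (rule always_eventually, rule allI)
      fix n
      show "(\<integral>\<^sup>+t. norm (f (t + v n) + g (t + v n) - (f t + g t)) \<partial>lborel) \<le>
       (\<integral>\<^sup>+t. norm (f (t + v n) - f t) \<partial>lborel) + (\<integral>\<^sup>+t. norm (g (t + v n) - g t) \<partial>lborel)"
        by (subst nn_integral_add[symmetric])
           (auto intro!: nn_integral_mono norm_diff_triangle_ineq simp flip: ennreal_plus)
    qed
  qed auto
next
  case (lim f s)
  have [measurable]: "f \<in> borel_measurable borel" "s i \<in> borel_measurable borel" for i
    using lim.hyps by (auto dest: borel_measurable_integrable)
  show ?case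
  proof (rule translation_continuous_approx)
    fix e :: real assume "e > 0"
    have "(\<lambda>i. \<integral>\<^sup>+t. norm (f t - s i t) \<partial>lborel) \<longlonglongrightarrow> 0"
    proof -
      have "(\<lambda>i. \<integral>\<^sup>+t. norm (f t - s i t) \<partial>lborel) \<longlonglongrightarrow> (\<integral>\<^sup>+t. 0 \<partial>(lborel :: real measure))"
      proof (rule nn_integral_dominated_convergence[where w="\<lambda>t. 3 * norm (f t)"])
        show "AE t in lborel. ennreal (norm (f t - s i t)) \<le> ennreal (3 * norm (f t))" for i
        proof (rule AE_I2, rule ennreal_leI)
          fix t
          have "norm (s i t) \<le> 2 * norm (f t)" using lim.hyps(3) by simp
          then show "norm (f t - s i t) \<le> 3 * norm (f t)"
            using norm_triangle_ineq4[of "f t" "s i t"] by linarith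
        qed
        show "AE t in lborel. (\<lambda>i. ennreal (norm (f t - s i t))) \<longlonglongrightarrow> 0"
        proof (rule AE_I2)
          fix t
          have "(\<lambda>i. ennreal (norm (f t - s i t))) \<longlonglongrightarrow> ennreal (norm (f t - f t))"
            using lim.hyps(2)[of t] by (intro tendsto_intros tendsto_ennrealI) auto
          then show "(\<lambda>i. ennreal (norm (f t - s i t))) \<longlonglongrightarrow> 0" by simp
        qed
        have "integrable lborel (\<lambda>t. 3 * norm (f t))" using lim.hyps(4) by auto
        then show "(\<integral>\<^sup>+t. ennreal (3 * norm (f t)) \<partial>lborel) < \<infinity>"
          unfolding integrable_iff_bounded by simp
      qed auto
      then show ?thesis by simp
    qed
    then have "\<forall>\<^sub>F i in sequentially. (\<integral>\<^sup>+t. norm (f t - s i t) \<partial>lborel) < ennreal e"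
      using \<open>e > 0\<close> by (auto simp: tendsto_ennreal_0_iff)
    then obtain i where "(\<integral>\<^sup>+t. norm (f t - s i t) \<partial>lborel) < ennreal e"
      by (auto simp: eventually_sequentially)
    then show "\<exists>h \<in> borel_measurable borel. (\<integral>\<^sup>+t. norm (f t - h t) \<partial>lborel) < ennreal e \<and>
        (\<lambda>n. \<integral>\<^sup>+t. norm (h (t + v n) - h t) \<partial>lborel) \<longlonglongrightarrow> 0"
      using lim.IH by (intro bexI[of _ "s i"] conjI) auto
  qed auto
qed

section \<open>Square-integrable functions\<close>

lemma L2_iff_nn_integral:
  "f \<in> L2 M \<longleftrightarrow> f \<in> borel_measurable M \<and> (\<integral>\<^sup>+t. (cmod (f t))\<^sup>2 \<partial>M) < \<infinity>"
  unfolding L2_def by (auto simp: integrable_iff_bounded)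

lemma L2_measurable: "f \<in> L2 M \<Longrightarrow> f \<in> borel_measurable M"
  by (simp add: L2_def)

lemma L2_norm_nonneg [simp]: "0 \<le> L2_norm M f"
  by (simp add: L2_norm_def)

lemma L2_norm_square: "(L2_norm M f)\<^sup>2 = (\<integral>t. (cmod (f t))\<^sup>2 \<partial>M)"
  by (simp add: L2_norm_def)

lemma nn_integral_L2_norm:
  "f \<in> L2 M \<Longrightarrow> (\<integral>\<^sup>+t. (cmod (f t))\<^sup>2 \<partial>M) = ennreal ((L2_norm M f)\<^sup>2)"
  unfolding L2_norm_square L2_def by (simp add: nn_integral_eq_integral)

lemma L2_nn_integralI:
  assumes "f \<in> borel_measurable M" "(\<integral>\<^sup>+t. (cmod (f t))\<^sup>2 \<partial>M) = ennreal (c\<^sup>2)" "0 \<le> c"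
  shows "f \<in> L2 M" "L2_norm M f = c"
proof -
  show *: "f \<in> L2 M" using assms by (simp add: L2_iff_nn_integral)
  show "L2_norm M f = c"
    using nn_integral_L2_norm[OF *] assms by simp
qed

lemma borel_measurable_cnj [measurable]:
  "f \<in> borel_measurable M \<Longrightarrow> (\<lambda>x. cnj (f x)) \<in> borel_measurable M"
  by (rule borel_measurable_continuous_on[where f=cnj]) (auto intro: continuous_intros)

lemma ennreal_power2_le_imp_le:
  assumes "a\<^sup>2 \<le> (ennreal b)\<^sup>2" "0 \<le> b"
  shows "a \<le> ennreal b"
proof (cases a)
  case (real r)
  then have "r\<^sup>2 \<le> b\<^sup>2" using assms by (simp add: ennreal_power)
  then show ?thesis using real assms(2) by (auto intro: ennreal_leI power2_le_imp_le)
next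
  case top
  then show ?thesis using assms by (simp add: ennreal_power top_unique power_eq_top_ennreal)
qed

lemma nn_integral_mult_L2_le:
  assumes "f \<in> L2 M" "g \<in> L2 M"
  shows "(\<integral>\<^sup>+t. cmod (f t) * cmod (g t) \<partial>M) \<le> ennreal (L2_norm M f * L2_norm M g)"
proof -
  have [measurable]: "f \<in> borel_measurable M" "g \<in> borel_measurable M"
    using assms by (auto dest: L2_measurable)
  have "(\<integral>\<^sup>+t. ennreal (cmod (f t)) * ennreal (cmod (g t)) \<partial>M)\<^sup>2 \<le>
        (\<integral>\<^sup>+t. (ennreal (cmod (f t)))\<^sup>2 \<partial>M) * (\<integral>\<^sup>+t. (ennreal (cmod (g t)))\<^sup>2 \<partial>M)"
    by (rule Cauchy_Schwarz_nn_integral) auto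
  also have "\<dots> = (ennreal (L2_norm M f * L2_norm M g))\<^sup>2"
    using assms by (simp add: ennreal_power nn_integral_L2_norm ennreal_mult power_mult_distrib)
  finally have "(\<integral>\<^sup>+t. ennreal (cmod (f t)) * ennreal (cmod (g t)) \<partial>M)\<^sup>2 \<le> (ennreal (L2_norm M f * L2_norm M g))\<^sup>2" .
  then have "(\<integral>\<^sup>+t. ennreal (cmod (f t)) * ennreal (cmod (g t)) \<partial>M) \<le> ennreal (L2_norm M f * L2_norm M g)"
    by (rule ennreal_power2_le_imp_le) simp
  then show ?thesis
    by (simp add: ennreal_mult)
qed

lemma L2_mult_integrable:
  assumes "f \<in> L2 M" "g \<in> L2 M"
  shows "integrable M (\<lambda>t. f t * cnj (g t))"
proof -
  have [measurable]: "f \<in> borel_measurable M" "g \<in> borel_measurable M"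
    using assms by (auto dest: L2_measurable)
  have "(\<integral>\<^sup>+t. cmod (f t) * cmod (g t) \<partial>M) < \<infinity>"
    using nn_integral_mult_L2_le[OF assms] by (rule le_less_trans) simp
  then show ?thesis
    by (simp add: integrable_iff_bounded norm_mult)
qed

lemma L2_Cauchy_Schwarz:
  assumes "f \<in> L2 M" "g \<in> L2 M"
  shows "cmod (L2_inner M f g) \<le> L2_norm M f * L2_norm M g"
proof -
  have "ennreal (cmod (L2_inner M f g)) \<le> (\<integral>\<^sup>+t. cmod (f t * cnj (g t)) \<partial>M)"
    unfolding L2_inner_def by (rule integral_norm_bound_ennreal) (rule L2_mult_integrable[OF assms])
  also have "\<dots> \<le> ennreal (L2_norm M f * L2_norm M g)"
    using nn_integral_mult_L2_le[OF assms] by (simp add: norm_mult)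
  finally show ?thesis by simp
qed

lemma L2_inner_self: "L2_inner M f f = of_real ((L2_norm M f)\<^sup>2)"
  unfolding L2_inner_def L2_norm_square
  by (subst integral_complex_of_real[symmetric]) (simp only: complex_norm_square)

lemma L2_zero: "(\<lambda>_. 0) \<in> L2 M"
  by (simp add: L2_def)

lemma L2_add:
  assumes "f \<in> L2 M" "g \<in> L2 M"
  shows "(\<lambda>t. f t + g t) \<in> L2 M"
proof -
  have [measurable]: "f \<in> borel_measurable M" "g \<in> borel_measurable M"
    using assms by (auto dest: L2_measurable)
  have "integrable M (\<lambda>t. 2 * (cmod (f t))\<^sup>2 + 2 * (cmod (g t))\<^sup>2)"
    using assms by (auto simp: L2_def)
  then have "integrable M (\<lambda>t. (cmod (f t + g t))\<^sup>2)"
  proof (rule Bochner_Integration.integrable_bound)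
    show "AE t in M. norm ((cmod (f t + g t))\<^sup>2) \<le> norm (2 * (cmod (f t))\<^sup>2 + 2 * (cmod (g t))\<^sup>2)"
    proof (rule AE_I2)
      fix t
      have "(cmod (f t + g t))\<^sup>2 \<le> (cmod (f t) + cmod (g t))\<^sup>2"
        by (intro power_mono norm_triangle_ineq) simp
      also have "\<dots> \<le> 2 * (cmod (f t))\<^sup>2 + 2 * (cmod (g t))\<^sup>2"
        using sum_squares_ge_zero[of "cmod (f t) - cmod (g t)" 0] by (simp add: power2_eq_square algebra_simps)
      finally show "norm ((cmod (f t + g t))\<^sup>2) \<le> norm (2 * (cmod (f t))\<^sup>2 + 2 * (cmod (g t))\<^sup>2)" by simp
    qed
  qed auto
  then show ?thesis by (simp add: L2_def)
qed

lemma L2_sum: "(\<And>k. k \<in> I \<Longrightarrow> f k \<in> L2 M) \<Longrightarrow> (\<lambda>t. \<Sum>k\<in>I. f k t) \<in> L2 M"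
  by (induction I rule: infinite_finite_induct) (auto intro: L2_zero L2_add)

lemma L2_inner_sum_left:
  assumes "\<And>k. k \<in> I \<Longrightarrow> f k \<in> L2 M" "g \<in> L2 M"
  shows "L2_inner M (\<lambda>t. \<Sum>k\<in>I. f k t) g = (\<Sum>k\<in>I. L2_inner M (f k) g)"
  unfolding L2_inner_def using assms
  by (simp add: sum_distrib_right L2_mult_integrable Bochner_Integration.integral_sum)

lemma L2_mult_indicator:
  assumes "f \<in> L2 M" "A \<in> sets M"
  shows "(\<lambda>t. f t * indicator A t) \<in> L2 M"
proof -
  have [measurable]: "f \<in> borel_measurable M" "A \<in> sets M"
    using assms by (auto dest: L2_measurable)
  have "integrable M (\<lambda>t. (cmod (f t))\<^sup>2)" using assms by (auto simp: L2_def)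
  then have "integrable M (\<lambda>t. (cmod (f t * indicator A t))\<^sup>2)"
    by (rule Bochner_Integration.integrable_bound) (auto simp: indicator_def)
  then show ?thesis by (simp add: L2_def)
qed

text \<open>The map \<open>a \<mapsto> \<bar>a\<bar> a\<close> is strongly monotone: twice the inner product of \<open>\<bar>a\<bar> a - \<bar>b\<bar> b\<close> with \<open>a - b\<close> equals
\<open>(\<bar>a\<bar> + \<bar>b\<bar>) (\<bar>a - b\<bar>\<^sup>2 + (\<bar>a\<bar> - \<bar>b\<bar>)\<^sup>2)\<close>. The inequality transfers continuity of translation from the
integrable function \<open>\<bar>f\<bar> f\<close> to the square-integrable function \<open>f\<close>.\<close>

lemma norm_diff_square_le:
  fixes a b :: "'a::real_inner"
  shows "(norm (a - b))\<^sup>2 \<le> 2 * norm (norm a *\<^sub>R a - norm b *\<^sub>R b)"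
proof (cases "a = b")
  case False
  define p q d where "p = norm a" and "q = norm b" and "d = norm (a - b)"
  have d: "0 < d" "d \<le> p + q"
    using False norm_triangle_ineq4[of a b] by (auto simp: p_def q_def d_def)
  have ab: "2 * inner a b = p\<^sup>2 + q\<^sup>2 - d\<^sup>2"
    unfolding p_def q_def d_def power2_norm_eq_inner by (simp add: inner_diff_left inner_diff_right inner_commute)
  have "2 * inner (p *\<^sub>R a - q *\<^sub>R b) (a - b) = 2 * p * p\<^sup>2 + 2 * q * q\<^sup>2 - (p + q) * (2 * inner a b)"
    unfolding p_def q_def power2_norm_eq_inner
    by (simp add: inner_diff_left inner_diff_right inner_commute algebra_simps)
  also have "\<dots> = (p + q) * (p - q)\<^sup>2 + (p + q) * d\<^sup>2"
    unfolding ab by (simp add: power2_eq_square algebra_simps)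
  finally have "(p + q) * d\<^sup>2 \<le> 2 * inner (p *\<^sub>R a - q *\<^sub>R b) (a - b)"
    using d by simp
  also have "\<dots> \<le> 2 * (norm (p *\<^sub>R a - q *\<^sub>R b) * d)"
    unfolding d_def using norm_cauchy_schwarz by auto
  finally have "(p + q) * d\<^sup>2 \<le> 2 * norm (p *\<^sub>R a - q *\<^sub>R b) * d" by simp
  moreover have "d * d\<^sup>2 \<le> (p + q) * d\<^sup>2"
    using d by (intro mult_right_mono) auto
  ultimately have "d\<^sup>2 * d \<le> 2 * norm (p *\<^sub>R a - q *\<^sub>R b) * d" by (simp add: mult.commute)
  then show ?thesis using d by (simp add: p_def q_def d_def)
qed simp

lemma translation_continuous_L2:
  fixes f :: "real \<Rightarrow> complex"
  assumes "f \<in> L2 lborel" and v: "v \<longlonglongrightarrow> 0"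
  shows "(\<lambda>n. \<integral>\<^sup>+t. (cmod (f (t + v n) - f t))\<^sup>2 \<partial>lborel) \<longlonglongrightarrow> 0"
proof (rule tendsto_sandwich[OF _ _ tendsto_const])
  let ?h = "\<lambda>t. cmod (f t) *\<^sub>R f t"
  have [measurable]: "f \<in> borel_measurable borel"
    using assms(1) by (auto dest: L2_measurable)
  have "integrable lborel ?h"
    using assms(1) by (subst integrable_norm_iff[symmetric]) (auto simp: L2_def power2_eq_square)
  then have "(\<lambda>n. ennreal 2 * (\<integral>\<^sup>+t. norm (?h (t + v n) - ?h t) \<partial>lborel)) \<longlonglongrightarrow> ennreal 2 * 0"
    by (intro ennreal_tendsto_cmult translation_continuous_L1[OF _ v]) simp_all
  then show "(\<lambda>n. 2 * (\<integral>\<^sup>+t. norm (?h (t + v n) - ?h t) \<partial>lborel)) \<longlonglongrightarrow> 0" by simp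
  show "\<forall>\<^sub>F n in sequentially. (\<integral>\<^sup>+t. (cmod (f (t + v n) - f t))\<^sup>2 \<partial>lborel) \<le>
     2 * (\<integral>\<^sup>+t. norm (?h (t + v n) - ?h t) \<partial>lborel)"
  proof (rule always_eventually, rule allI)
    fix n
    have "(\<integral>\<^sup>+t. (cmod (f (t + v n) - f t))\<^sup>2 \<partial>lborel) \<le> (\<integral>\<^sup>+t. 2 * ennreal (norm (?h (t + v n) - ?h t)) \<partial>lborel)"
    proof (rule nn_integral_mono)
      fix t
      have "ennreal ((cmod (f (t + v n) - f t))\<^sup>2) \<le> ennreal (2 * norm (?h (t + v n) - ?h t))"
        by (rule ennreal_leI) (rule norm_diff_square_le)
      then show "ennreal ((cmod (f (t + v n) - f t))\<^sup>2) \<le> 2 * ennreal (norm (?h (t + v n) - ?h t))"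
        by (simp add: ennreal_mult)
    qed
    then show "(\<integral>\<^sup>+t. (cmod (f (t + v n) - f t))\<^sup>2 \<partial>lborel) \<le>
       2 * (\<integral>\<^sup>+t. norm (?h (t + v n) - ?h t) \<partial>lborel)"
      by (subst (asm) nn_integral_cmult) auto
  qed
qed auto

lemma L2_translate:
  fixes u :: real
  assumes "f \<in> L2 lborel"
  shows "(\<lambda>t. f (t + u)) \<in> L2 lborel" "L2_norm lborel (\<lambda>t. f (t + u)) = L2_norm lborel f"
proof -
  have [measurable]: "f \<in> borel_measurable borel"
    using assms(1) by (auto dest: L2_measurable)
  have "(\<integral>\<^sup>+t. (cmod (f (t + u)))\<^sup>2 \<partial>lborel) = ennreal ((L2_norm lborel f)\<^sup>2)"
    using nn_integral_L2_norm[OF assms] by (subst nn_integral_lborel_shift[where f="\<lambda>t::real. ennreal ((cmod (f t))\<^sup>2)"]) auto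
  then show "(\<lambda>t. f (t + u)) \<in> L2 lborel" "L2_norm lborel (\<lambda>t. f (t + u)) = L2_norm lborel f"
    by (auto intro: L2_nn_integralI)
qed

lemma L2_diff:
  assumes "f \<in> L2 M" "g \<in> L2 M"
  shows "(\<lambda>t. f t - g t) \<in> L2 M"
proof -
  have "(\<lambda>t. - g t) \<in> L2 M" using assms by (auto simp: L2_def)
  from L2_add[OF assms(1) this] show ?thesis by simp
qed

section \<open>Plancherel's identity\<close>

definition autocorrelation :: "(real \<Rightarrow> complex) \<Rightarrow> real \<Rightarrow> complex" where
  "autocorrelation f u = L2_inner lborel (\<lambda>t. f (t + u)) f"

lemma autocorrelation_bound:
  "f \<in> L2 lborel \<Longrightarrow> cmod (autocorrelation f u) \<le> (L2_norm lborel f)\<^sup>2"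
  unfolding autocorrelation_def
  using L2_Cauchy_Schwarz[OF L2_translate(1), of f f u] by (simp add: L2_translate(2) power2_eq_square)

lemma autocorrelation_0: "autocorrelation f 0 = of_real ((L2_norm lborel f)\<^sup>2)"
  by (simp add: autocorrelation_def L2_inner_self)

lemma autocorrelation_continuous_at_0:
  assumes f: "f \<in> L2 lborel" and v: "v \<longlonglongrightarrow> 0"
  shows "(\<lambda>n. autocorrelation f (v n)) \<longlonglongrightarrow> autocorrelation f 0"
proof -
  let ?d = "\<lambda>n t. f (t + v n) - f t"
  have d: "?d n \<in> L2 lborel" for n
    by (intro L2_diff L2_translate f)
  have "(\<lambda>n. ennreal ((L2_norm lborel (?d n))\<^sup>2)) \<longlonglongrightarrow> 0"
    using translation_continuous_L2[OF f v] by (simp add: nn_integral_L2_norm[OF d])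
  then have "(\<lambda>n. sqrt (enn2real (ennreal ((L2_norm lborel (?d n))\<^sup>2)))) \<longlonglongrightarrow> sqrt (enn2real 0)"
    by (intro tendsto_real_sqrt tendsto_enn2real) auto
  then have "(\<lambda>n. L2_norm lborel (?d n)) \<longlonglongrightarrow> 0" by simp
  then have lim: "(\<lambda>n. L2_norm lborel (?d n) * L2_norm lborel f) \<longlonglongrightarrow> 0"
    by (rule tendsto_mult_left_zero)
  have eq: "autocorrelation f (v n) - autocorrelation f 0 = L2_inner lborel (?d n) f" for n
    unfolding autocorrelation_def L2_inner_def
    by (simp add: L2_mult_integrable L2_translate f left_diff_distrib
             flip: Bochner_Integration.integral_diff)
  have "(\<lambda>n. autocorrelation f (v n) - autocorrelation f 0) \<longlonglongrightarrow> 0"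
    unfolding eq by (rule Lim_null_comparison[OF always_eventually lim]) (auto intro!: L2_Cauchy_Schwarz d f)
  then show ?thesis by (simp add: LIM_zero_iff)
qed

definition fourier :: "(real \<Rightarrow> complex) \<Rightarrow> real \<Rightarrow> complex" where
  "fourier f \<xi> = (\<integral>t. f t * exp (- 2 * of_real pi * \<i> * of_real \<xi> * of_real t) \<partial>lborel)"

lemma norm_exp_character [simp]:
  "cmod (exp (- (2 * of_real pi * \<i> * of_real \<xi> * of_real t))) = 1"
  "cmod (exp (2 * of_real pi * \<i> * of_real \<xi> * of_real t)) = 1"
  by (simp_all add: norm_exp_eq_Re)

lemma borel_measurable_fourier [measurable]:
  assumes [measurable]: "f \<in> borel_measurable borel"
  shows "fourier f \<in> borel_measurable borel"
  unfolding fourier_def by measurable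

lemma fourier_bound: "cmod (fourier f \<xi>) \<le> (\<integral>t. cmod (f t) \<partial>lborel)"
  unfolding fourier_def by (rule integral_norm_bound[THEN order_trans]) (simp add: norm_mult)

lemma integrable_correlation_kernel:
  assumes f: "integrable lborel (f :: real \<Rightarrow> complex)"
  shows "integrable (lborel \<Otimes>\<^sub>M lborel) (\<lambda>(t, u). f (t + u) * cnj (f t))"
proof -
  have [measurable]: "f \<in> borel_measurable borel"
    using f by (auto dest: borel_measurable_integrable)
  have fin: "(\<integral>\<^sup>+t. cmod (f t) \<partial>lborel) < \<infinity>"
    using f by (simp add: integrable_iff_bounded)
  have "(\<integral>\<^sup>+t. (\<integral>\<^sup>+u. cmod (f (t + u)) * cmod (f t) \<partial>lborel) \<partial>lborel) =
      (\<integral>\<^sup>+t. (\<integral>\<^sup>+u. cmod (f u) \<partial>lborel) * cmod (f t) \<partial>lborel)"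
  proof (rule nn_integral_cong)
    fix t
    have "(\<integral>\<^sup>+u. cmod (f (t + u)) * cmod (f t) \<partial>lborel) = (\<integral>\<^sup>+u. cmod (f (u + t)) \<partial>lborel) * cmod (f t)"
      by (subst nn_integral_multc[symmetric]) (auto simp: ennreal_mult add.commute)
    then show "(\<integral>\<^sup>+u. cmod (f (t + u)) * cmod (f t) \<partial>lborel) = (\<integral>\<^sup>+u. cmod (f u) \<partial>lborel) * cmod (f t)"
      by (subst (asm) nn_integral_lborel_shift) auto
  qed
  also have "\<dots> = (\<integral>\<^sup>+u. cmod (f u) \<partial>lborel) * (\<integral>\<^sup>+t. cmod (f t) \<partial>lborel)"
    by (rule nn_integral_cmult) simp
  also have "\<dots> < \<infinity>" using fin by (simp add: ennreal_mult_less_top)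
  finally show ?thesis
    by (simp add: integrable_iff_bounded lborel.nn_integral_fst[symmetric] split_beta' norm_mult)
qed

lemma autocorrelation_integrable:
  assumes f: "integrable lborel f"
  shows "integrable lborel (autocorrelation f)"
  unfolding autocorrelation_def L2_inner_def
  using lborel_pair.integrable_snd[OF integrable_correlation_kernel[OF f]] by simp

text \<open>The Wiener-Khinchin relation: the autocorrelation is the convolution of \<open>f\<close> with its conjugate reflection.\<close>

lemma fourier_autocorrelation:
  assumes f: "integrable lborel f"
  shows "fourier (autocorrelation f) \<xi> = of_real ((cmod (fourier f \<xi>))\<^sup>2)"
proof -
  have [measurable]: "f \<in> borel_measurable borel"
    using f by (auto dest: borel_measurable_integrable)
  let ?e = "\<lambda>t. exp (- 2 * of_real pi * \<i> * of_real \<xi> * of_real t) :: complex"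
  have e_add: "?e (t + u) * cnj (?e t) = ?e u" for t u :: real
    by (simp add: exp_cnj flip: exp_add) (simp add: algebra_simps)
  have "integrable (lborel \<Otimes>\<^sub>M lborel) (\<lambda>(t, u). f (t + u) * cnj (f t) * ?e u)"
    by (rule Bochner_Integration.integrable_bound[OF integrable_correlation_kernel[OF f]])
       (auto simp: norm_mult)
  then have "(\<integral>u. (\<integral>t. f (t + u) * cnj (f t) * ?e u \<partial>lborel) \<partial>lborel) =
    (\<integral>t. (\<integral>u. f (t + u) * cnj (f t) * ?e u \<partial>lborel) \<partial>lborel)"
    by (rule lborel_pair.Fubini_integral)
  also have "\<dots> = (\<integral>t. fourier f \<xi> * cnj (f t * ?e t) \<partial>lborel)"
  proof (rule Bochner_Integration.integral_cong[OF refl])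
    fix t
    have "(\<integral>u. f (t + u) * cnj (f t) * ?e u \<partial>lborel) = (\<integral>u. (f (t + u) * ?e (t + u)) * cnj (f t * ?e t) \<partial>lborel)"
    proof (rule Bochner_Integration.integral_cong[OF refl])
      fix u
      have "f (t + u) * cnj (f t) * ?e u = f (t + u) * cnj (f t) * (?e (t + u) * cnj (?e t))"
        by (simp only: e_add)
      also have "\<dots> = (f (t + u) * ?e (t + u)) * cnj (f t * ?e t)"
        by (simp only: complex_cnj_mult mult_ac)
      finally show "f (t + u) * cnj (f t) * ?e u = (f (t + u) * ?e (t + u)) * cnj (f t * ?e t)" .
    qed
    also have "\<dots> = (\<integral>u. f (t + u) * ?e (t + u) \<partial>lborel) * cnj (f t * ?e t)"
      by simp
    also have "(\<integral>u. f (t + u) * ?e (t + u) \<partial>lborel) = fourier f \<xi>"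
      unfolding fourier_def
      using lborel_integral_real_affine[of 1 "\<lambda>u. f u * ?e u" t] by simp
    finally show "(\<integral>u. f (t + u) * cnj (f t) * ?e u \<partial>lborel) = fourier f \<xi> * cnj (f t * ?e t)" .
  qed
  also have "\<dots> = fourier f \<xi> * cnj (fourier f \<xi>)"
    unfolding fourier_def by (simp del: complex_cnj_mult)
  also have "\<dots> = of_real ((cmod (fourier f \<xi>))\<^sup>2)"
    by (simp only: complex_norm_square)
  finally show ?thesis
    unfolding fourier_def[of "autocorrelation f"] autocorrelation_def L2_inner_def by simp
qed

lemma std_normal_density_exp_integral:
  "(CLINT y|lborel. of_real (std_normal_density y) * exp (\<i> * of_real (s * y))) = of_real (exp (- s\<^sup>2 / 2))"
proof -
  have "char std_normal_distribution s = (CLINT y|lborel. std_normal_density y *\<^sub>R exp (\<i> * of_real (s * y)))"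
    unfolding char_def
  proof (rule integral_density)
    show "(\<lambda>y. exp (\<i> * of_real (s * y))) \<in> borel_measurable lborel" by measurable
  qed simp_all
  then show ?thesis
    unfolding char_std_normal_distribution scaleR_conv_of_real by (rule sym)
qed

text \<open>The transform is the density of a normal distribution that concentrates at \<open>0\<close> as \<open>c\<close> grows.\<close>

lemma dilated_gaussian_fourier:
  fixes c :: real assumes c: "c > 0"
  shows "fourier (\<lambda>\<xi>. of_real (exp (- (\<xi> / c)\<^sup>2 / 2))) u = of_real (2 * pi * c * std_normal_density (2 * pi * c * u))"
proof -
  have "fourier (\<lambda>\<xi>. of_real (exp (- (\<xi> / c)\<^sup>2 / 2))) u
     = (CLINT y|lborel. c *\<^sub>R (of_real (exp (- y\<^sup>2 / 2)) * exp (\<i> * of_real (- (2 * pi * c * u) * y))))"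
  proof -
    let ?F = "\<lambda>\<xi>. of_real (exp (- (\<xi> / c)\<^sup>2 / 2)) * exp (- 2 * of_real pi * \<i> * of_real u * of_real \<xi>) :: complex"
    have "(\<integral>\<xi>. ?F \<xi> \<partial>lborel) = \<bar>c\<bar> *\<^sub>R (\<integral>y. ?F (0 + c * y) \<partial>lborel)"
      using c by (intro lborel_integral_real_affine) auto
    also have "\<dots> = (\<integral>y. \<bar>c\<bar> *\<^sub>R ?F (0 + c * y) \<partial>lborel)"
      by (rule integral_scaleR_right[symmetric]) 
    also have "\<dots> = (CLINT y|lborel. c *\<^sub>R (of_real (exp (- y\<^sup>2 / 2)) * exp (\<i> * of_real (- (2 * pi * c * u) * y))))"
      using c by (intro Bochner_Integration.integral_cong refl) (simp add: mult_ac)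
    finally show ?thesis unfolding fourier_def .
  qed
  also have "\<dots> = (CLINT y|lborel. of_real (c * sqrt (2 * pi)) * (of_real (std_normal_density y) * exp (\<i> * of_real (- (2 * pi * c * u) * y))))"
    by (intro Bochner_Integration.integral_cong refl)
       (simp add: std_normal_density_def scaleR_conv_of_real)
  also have "\<dots> = of_real (c * sqrt (2 * pi)) * of_real (exp (- (- (2 * pi * c * u))\<^sup>2 / 2))"
    by (subst integral_mult_right_zero, subst std_normal_density_exp_integral) (rule refl)
  also have "\<dots> = of_real (2 * pi * c * std_normal_density (2 * pi * c * u))"
  proof -
    have "2 * pi * c * std_normal_density (2 * pi * c * u) = c * (2 * pi / sqrt (2 * pi)) * exp (- (2 * pi * c * u)\<^sup>2 / 2)"
      unfolding std_normal_density_def by simp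
    also have "2 * pi / sqrt (2 * pi) = sqrt (2 * pi)"
      by (rule real_div_sqrt) simp
    finally show ?thesis by (simp only: of_real_mult power2_minus)
  qed
  finally show ?thesis .
qed

lemma dilated_gaussian_integrable:
  fixes c :: real assumes c: "c > 0"
  shows "integrable lborel (\<lambda>\<xi>. exp (- (\<xi> / c)\<^sup>2 / 2))"
proof -
  have "integrable lborel (\<lambda>\<xi>. sqrt (2 * pi) * std_normal_density (0 + (1 / c) * \<xi>))"
    using c by (intro integrable_mult_right lborel_integrable_real_affine) auto
  then show ?thesis by (simp add: std_normal_density_def)
qed

lemma fourier_multiplication_formula:
  assumes f: "integrable lborel f" and h: "integrable lborel h"
  shows "(\<integral>\<xi>. h \<xi> * fourier f \<xi> \<partial>lborel) = (\<integral>t. f t * fourier h t \<partial>lborel)"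
proof -
  have [measurable]: "f \<in> borel_measurable borel" "h \<in> borel_measurable borel"
    using f h by (auto dest: borel_measurable_integrable)
  let ?k = "\<lambda>\<xi> t. h \<xi> * f t * exp (- 2 * of_real pi * \<i> * of_real \<xi> * of_real t)"
  have "(\<integral>\<^sup>+\<xi>. (\<integral>\<^sup>+t. cmod (h \<xi>) * cmod (f t) \<partial>lborel) \<partial>lborel) = (\<integral>\<^sup>+\<xi>. cmod (h \<xi>) \<partial>lborel) * (\<integral>\<^sup>+t. cmod (f t) \<partial>lborel)"
    by (simp add: ennreal_mult nn_integral_cmult nn_integral_multc)
  also have "\<dots> < \<infinity>" using f h by (simp add: integrable_iff_bounded ennreal_mult_less_top)
  finally have "integrable (lborel \<Otimes>\<^sub>M lborel) (\<lambda>(\<xi>, t). ?k \<xi> t)"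
    by (simp add: integrable_iff_bounded lborel.nn_integral_fst[symmetric] split_beta' norm_mult)
  then have "(\<integral>t. (\<integral>\<xi>. ?k \<xi> t \<partial>lborel) \<partial>lborel) = (\<integral>\<xi>. (\<integral>t. ?k \<xi> t \<partial>lborel) \<partial>lborel)"
    by (rule lborel_pair.Fubini_integral)
  moreover have "(\<integral>t. ?k \<xi> t \<partial>lborel) = h \<xi> * fourier f \<xi>" for \<xi>
    unfolding fourier_def
    by (rule trans[OF _ integral_mult_right_zero], rule Bochner_Integration.integral_cong) (simp_all add: mult_ac)
  moreover have "(\<integral>\<xi>. ?k \<xi> t \<partial>lborel) = f t * fourier h t" for t
    unfolding fourier_def
    by (rule trans[OF _ integral_mult_right_zero], rule Bochner_Integration.integral_cong) (simp_all add: mult_ac)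
  ultimately show ?thesis by simp
qed

text \<open>The weight makes the energy of the transform absolutely convergent as a double integral. Replacing
\<open>\<bar>fourier f\<bar>\<^sup>2\<close> by the transform of the autocorrelation and moving the transform over to the weight
leaves a Gaussian average of the autocorrelation at scale \<open>1 / c\<close>.\<close>

lemma gaussian_regularised_energy:
  fixes c :: real
  assumes f: "integrable lborel f" and c: "c > 0"
  shows "(\<integral>\<xi>. exp (- (\<xi> / c)\<^sup>2 / 2) * (cmod (fourier f \<xi>))\<^sup>2 \<partial>lborel) =
    Re (\<integral>y. of_real (std_normal_density y) * autocorrelation f (y / (2 * pi * c)) \<partial>lborel)"
proof -
  let ?w = "\<lambda>\<xi>. exp (- (\<xi> / c)\<^sup>2 / 2)"
  have "complex_of_real (\<integral>\<xi>. ?w \<xi> * (cmod (fourier f \<xi>))\<^sup>2 \<partial>lborel) =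
     (\<integral>\<xi>. of_real (?w \<xi>) * fourier (autocorrelation f) \<xi> \<partial>lborel)"
    by (simp only: integral_complex_of_real[symmetric] fourier_autocorrelation[OF f] of_real_mult)
  also have "\<dots> = (\<integral>u. autocorrelation f u * fourier (\<lambda>\<xi>. of_real (?w \<xi>)) u \<partial>lborel)"
    using dilated_gaussian_integrable[OF c]
    by (intro fourier_multiplication_formula autocorrelation_integrable f) (rule integrable_of_real)
  also have "\<dots> = (\<integral>u. autocorrelation f u * of_real (2 * pi * c * std_normal_density (2 * pi * c * u)) \<partial>lborel)"
    by (simp only: dilated_gaussian_fourier[OF c])
  also have "\<dots> = (\<integral>y. of_real (std_normal_density y) * autocorrelation f (y / (2 * pi * c)) \<partial>lborel)"
  proof -
    let ?F = "\<lambda>y. of_real (std_normal_density y) * autocorrelation f (y / (2 * pi * c))"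
    have pos: "\<bar>2 * pi * c\<bar> = 2 * pi * c" "2 * pi * c \<noteq> 0" using c by simp_all
    have "(\<integral>y. ?F y \<partial>lborel) = \<bar>2 * pi * c\<bar> *\<^sub>R (\<integral>u. ?F (0 + 2 * pi * c * u) \<partial>lborel)"
      by (rule lborel_integral_real_affine) (rule pos)
    also have "\<dots> = (\<integral>u. \<bar>2 * pi * c\<bar> *\<^sub>R ?F (0 + 2 * pi * c * u) \<partial>lborel)"
      by (rule integral_scaleR_right[symmetric])
    also have "\<dots> = (\<integral>u. autocorrelation f u * of_real (2 * pi * c * std_normal_density (2 * pi * c * u)) \<partial>lborel)"
    proof (rule Bochner_Integration.integral_cong[OF refl])
      fix u
      have "(0 + 2 * pi * c * u) / (2 * pi * c) = u" using pos(2) by simp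
      then show "\<bar>2 * pi * c\<bar> *\<^sub>R ?F (0 + 2 * pi * c * u) = autocorrelation f u * of_real (2 * pi * c * std_normal_density (2 * pi * c * u))"
        unfolding pos(1) scaleR_conv_of_real by (simp only: add_0 of_real_mult mult_ac)
    qed
    finally show ?thesis by (rule sym)
  qed
  finally have "Re (complex_of_real (\<integral>\<xi>. ?w \<xi> * (cmod (fourier f \<xi>))\<^sup>2 \<partial>lborel)) =
     Re (\<integral>y. of_real (std_normal_density y) * autocorrelation f (y / (2 * pi * c)) \<partial>lborel)"
    by (rule arg_cong)
  then show ?thesis by (simp only: Re_complex_of_real)
qed

lemma autocorrelation_measurable [measurable]:
  "integrable lborel f \<Longrightarrow> autocorrelation f \<in> borel_measurable borel"
  using autocorrelation_integrable by (auto dest: borel_measurable_integrable)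

text \<open>The weights \<open>exp (- (\<xi> / n)\<^sup>2 / 2)\<close> increase to \<open>1\<close>, so the weighted energies converge to the full energy,
finite or not; as averages of a bounded function that is continuous at \<open>0\<close>, they also converge to the
value of the autocorrelation there.\<close>

lemma plancherel:
  assumes f1: "integrable lborel f" and f2: "f \<in> L2 lborel"
  shows "(\<integral>\<^sup>+\<xi>. (cmod (fourier f \<xi>))\<^sup>2 \<partial>lborel) = (\<integral>\<^sup>+t. (cmod (f t))\<^sup>2 \<partial>lborel)"
proof -
  have [measurable]: "f \<in> borel_measurable borel"
    using f1 by (auto dest: borel_measurable_integrable)
  note [measurable] = autocorrelation_measurable[OF f1]
  define w where "w = (\<lambda>n \<xi>. exp (- (\<xi> / real (Suc n))\<^sup>2 / 2))"
  define E where "E = (\<lambda>n. \<integral>\<xi>. w n \<xi> * (cmod (fourier f \<xi>))\<^sup>2 \<partial>lborel)"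
  have [measurable]: "w n \<in> borel_measurable borel" for n unfolding w_def by measurable
  have w_int: "integrable lborel (\<lambda>\<xi>. w n \<xi> * (cmod (fourier f \<xi>))\<^sup>2)" for n
  proof (rule Bochner_Integration.integrable_bound)
    show "integrable lborel (\<lambda>\<xi>. w n \<xi> * (\<integral>t. cmod (f t) \<partial>lborel)\<^sup>2)"
      unfolding w_def by (intro integrable_mult_left dilated_gaussian_integrable) simp
    show "AE \<xi> in lborel. norm (w n \<xi> * (cmod (fourier f \<xi>))\<^sup>2) \<le> norm (w n \<xi> * (\<integral>t. cmod (f t) \<partial>lborel)\<^sup>2)"
      by (rule AE_I2) (auto simp: abs_mult intro!: mult_left_mono power_mono fourier_bound)
  qed auto
  have "(\<lambda>n. \<integral>\<^sup>+\<xi>. ennreal (w n \<xi> * (cmod (fourier f \<xi>))\<^sup>2) \<partial>lborel) \<longlonglongrightarrow> (\<integral>\<^sup>+\<xi>. (cmod (fourier f \<xi>))\<^sup>2 \<partial>lborel)"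
  proof (rule nn_integral_LIMSEQ)
    have "w m \<xi> \<le> w n \<xi>" if "m \<le> n" for m n \<xi>
      using that unfolding w_def
      by (auto simp: power_divide intro!: divide_left_mono power_mono)
    then show "incseq (\<lambda>n \<xi>. ennreal (w n \<xi> * (cmod (fourier f \<xi>))\<^sup>2))"
      by (auto simp: incseq_def le_fun_def intro!: ennreal_leI mult_right_mono)
    fix \<xi>
    have "(\<lambda>n. \<xi> / real (Suc n)) \<longlonglongrightarrow> 0"
      by (rule LIMSEQ_Suc[OF lim_const_over_n])
    then have "(\<lambda>n. w n \<xi> * (cmod (fourier f \<xi>))\<^sup>2) \<longlonglongrightarrow> exp (- 0\<^sup>2 / 2) * (cmod (fourier f \<xi>))\<^sup>2"
      unfolding w_def by (intro tendsto_intros) auto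
    then show "(\<lambda>n. ennreal (w n \<xi> * (cmod (fourier f \<xi>))\<^sup>2)) \<longlonglongrightarrow> ennreal ((cmod (fourier f \<xi>))\<^sup>2)"
      by (intro tendsto_ennrealI) simp
  qed auto
  moreover have "(\<integral>\<^sup>+\<xi>. ennreal (w n \<xi> * (cmod (fourier f \<xi>))\<^sup>2) \<partial>lborel) = ennreal (E n)" for n
    unfolding E_def by (intro nn_integral_eq_integral w_int AE_I2) (simp add: w_def)
  ultimately have lim1: "(\<lambda>n. ennreal (E n)) \<longlonglongrightarrow> (\<integral>\<^sup>+\<xi>. (cmod (fourier f \<xi>))\<^sup>2 \<partial>lborel)"
    by simp
  let ?I = "\<lambda>n. \<integral>y. of_real (std_normal_density y) * autocorrelation f (y / (2 * pi * real (Suc n))) \<partial>lborel"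
  have "?I \<longlonglongrightarrow> (\<integral>y. of_real (std_normal_density y) * autocorrelation f 0 \<partial>lborel)"
  proof (rule integral_dominated_convergence[where w="\<lambda>y. std_normal_density y * (L2_norm lborel f)\<^sup>2"])
    show "integrable lborel (\<lambda>y. std_normal_density y * (L2_norm lborel f)\<^sup>2)"
      by (intro integrable_mult_left) simp
    show "AE y in lborel. (\<lambda>n. of_real (std_normal_density y) * autocorrelation f (y / (2 * pi * real (Suc n))))
       \<longlonglongrightarrow> of_real (std_normal_density y) * autocorrelation f 0"
    proof (rule AE_I2)
      fix y :: real
      have "(\<lambda>n. (y / (2 * pi)) / real (Suc n)) \<longlonglongrightarrow> 0"
        by (rule LIMSEQ_Suc[OF lim_const_over_n])
      then have "(\<lambda>n. y / (2 * pi * real (Suc n))) \<longlonglongrightarrow> 0"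
        by (simp only: divide_divide_eq_left)
      then show "(\<lambda>n. of_real (std_normal_density y) * autocorrelation f (y / (2 * pi * real (Suc n))))
       \<longlonglongrightarrow> of_real (std_normal_density y) * autocorrelation f 0"
        by (intro tendsto_intros autocorrelation_continuous_at_0[OF f2])
    qed
    show "AE y in lborel. cmod (of_real (std_normal_density y) * autocorrelation f (y / (2 * pi * real (Suc n))))
        \<le> std_normal_density y * (L2_norm lborel f)\<^sup>2" for n
      by (rule AE_I2) (auto simp: norm_mult intro!: mult_left_mono autocorrelation_bound f2)
  qed auto
  also have "(\<integral>y. of_real (std_normal_density y) * autocorrelation f 0 \<partial>lborel) = of_real ((L2_norm lborel f)\<^sup>2)"
  proof -
    have "(\<integral>y. complex_of_real (std_normal_density y) \<partial>lborel) = 1"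
      by (subst integral_complex_of_real) simp
    then show ?thesis by (simp add: autocorrelation_0)
  qed
  finally have "(\<lambda>n. Re (?I n)) \<longlonglongrightarrow> Re (of_real ((L2_norm lborel f)\<^sup>2))"
    by (rule tendsto_Re)
  moreover have "Re (?I n) = E n" for n
    unfolding E_def w_def by (rule gaussian_regularised_energy[OF f1, symmetric]) simp
  ultimately have "E \<longlonglongrightarrow> (L2_norm lborel f)\<^sup>2" by simp
  then have "(\<lambda>n. ennreal (E n)) \<longlonglongrightarrow> ennreal ((L2_norm lborel f)\<^sup>2)"
    by (rule tendsto_ennrealI)
  from LIMSEQ_unique[OF lim1 this] show ?thesis
    by (simp add: nn_integral_L2_norm[OF f2])
qed

section \<open>Moyal's identity and the adjoint of the transform\<close>

lemma stft_eq_fourier: "stft g f (x, \<xi>) = fourier (\<lambda>t. f t * cnj (g (t - x))) \<xi>"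
  by (simp add: stft_eq fourier_def)

lemma L2_inner_commute: "L2_inner M f g = cnj (L2_inner M g f)"
  using Bochner_Integration.integral_cnj[of M "\<lambda>t. g t * cnj (f t)"] by (simp add: L2_inner_def mult.commute)

lemma norm_tf_shift: "cmod (tf_shift z g t) = cmod (g (t - fst z))"
  by (simp add: tf_shift_def split_beta' norm_mult)

lemma tf_shift_L2:
  assumes "g \<in> L2 lborel"
  shows "tf_shift z g \<in> L2 lborel" "L2_norm lborel (tf_shift z g) = L2_norm lborel g"
proof -
  have [measurable]: "g \<in> borel_measurable borel"
    using assms by (auto dest: L2_measurable)
  have meas: "tf_shift z g \<in> borel_measurable lborel"
    unfolding tf_shift_def split_beta' by measurable
  have eq: "(cmod (tf_shift z g t))\<^sup>2 = (cmod (g (t + - fst z)))\<^sup>2" for t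
    by (simp add: norm_tf_shift)
  show "tf_shift z g \<in> L2 lborel"
    using L2_translate(1)[OF assms, of "- fst z"] meas by (simp add: L2_def eq)
  show "L2_norm lborel (tf_shift z g) = L2_norm lborel g"
    using L2_translate(2)[OF assms, of "- fst z"] by (simp add: L2_norm_def eq)
qed

lemma fst_snd_borel_measurable [measurable]:
  "fst \<in> borel_measurable (borel :: ('a::second_countable_topology \<times> 'b::second_countable_topology) measure)"
  "snd \<in> borel_measurable (borel :: ('a \<times> 'b) measure)"
  by (auto intro!: borel_measurable_continuous_onI continuous_intros)

lemma tf_shift_measurable [measurable (raw)]:
  assumes [measurable]: "g \<in> borel_measurable borel" "a \<in> borel_measurable M" "b \<in> borel_measurable M"
  shows "(\<lambda>p. tf_shift (a p) g (b p)) \<in> borel_measurable M"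
  unfolding tf_shift_def split_beta' by measurable

lemma stft_measurable [measurable]:
  assumes [measurable]: "f \<in> borel_measurable borel" "g \<in> borel_measurable borel"
  shows "stft g f \<in> borel_measurable borel"
  unfolding stft_def[abs_def] L2_inner_def by measurable

text \<open>For fixed \<open>x\<close> the function \<open>\<xi> \<mapsto> stft g f (x, \<xi>)\<close> is the Fourier transform of a product of two
square-integrable functions. That product is always integrable, and by Tonelli's theorem it is
square-integrable for almost every \<open>x\<close>, which is enough to apply Plancherel's identity under the
integral over \<open>x\<close>.\<close>

lemma nn_integral_stft_square:
  assumes f: "f \<in> L2 lborel" and g: "g \<in> L2 lborel"
  shows "(\<integral>\<^sup>+z. (cmod (stft g f z))\<^sup>2 \<partial>lborel) = ennreal ((L2_norm lborel f * L2_norm lborel g)\<^sup>2)"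
proof -
  have [measurable]: "f \<in> borel_measurable borel" "g \<in> borel_measurable borel"
    using f g by (auto dest: L2_measurable)
  let ?p = "\<lambda>x t. f t * cnj (g (t - x))"
  have *: "(\<integral>\<^sup>+x. (\<integral>\<^sup>+t. (cmod (?p x t))\<^sup>2 \<partial>lborel) \<partial>lborel) = ennreal ((L2_norm lborel f * L2_norm lborel g)\<^sup>2)"
  proof -
    have "(\<integral>\<^sup>+x. (\<integral>\<^sup>+t. (cmod (?p x t))\<^sup>2 \<partial>lborel) \<partial>lborel) = (\<integral>\<^sup>+t. (\<integral>\<^sup>+x. (cmod (?p x t))\<^sup>2 \<partial>lborel) \<partial>lborel)"
      by (rule lborel_pair.Fubini') simp
    also have "\<dots> = (\<integral>\<^sup>+t. ennreal ((cmod (f t))\<^sup>2) * ennreal ((L2_norm lborel g)\<^sup>2) \<partial>lborel)"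
    proof (rule nn_integral_cong)
      fix t
      have "(\<integral>\<^sup>+x. (cmod (?p x t))\<^sup>2 \<partial>lborel) = (\<integral>\<^sup>+x. ennreal ((cmod (f t))\<^sup>2) * ennreal ((cmod (g (t - x)))\<^sup>2) \<partial>lborel)"
        by (simp add: norm_mult power_mult_distrib ennreal_mult)
      also have "\<dots> = ennreal ((cmod (f t))\<^sup>2) * (\<integral>\<^sup>+x. ennreal ((cmod (g (t - x)))\<^sup>2) \<partial>lborel)"
        by (rule nn_integral_cmult) simp
      also have "(\<integral>\<^sup>+x. ennreal ((cmod (g (t - x)))\<^sup>2) \<partial>lborel) = ennreal ((L2_norm lborel g)\<^sup>2)"
        using nn_integral_L2_norm[OF g] by (subst nn_integral_lborel_reflect[where f="\<lambda>x::real. ennreal ((cmod (g x))\<^sup>2)"]) auto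
      finally show "(\<integral>\<^sup>+x. (cmod (?p x t))\<^sup>2 \<partial>lborel) = ennreal ((cmod (f t))\<^sup>2) * ennreal ((L2_norm lborel g)\<^sup>2)" .
    qed
    also have "\<dots> = ennreal ((L2_norm lborel f * L2_norm lborel g)\<^sup>2)"
      by (simp add: nn_integral_multc nn_integral_L2_norm f power_mult_distrib ennreal_mult)
    finally show ?thesis .
  qed
  have "AE x in lborel. (\<integral>\<^sup>+t. (cmod (?p x t))\<^sup>2 \<partial>lborel) \<noteq> \<infinity>"
    by (rule nn_integral_PInf_AE) (auto simp: *)
  then have "AE x in lborel. ?p x \<in> L2 lborel"
    by eventually_elim (simp add: L2_iff_nn_integral less_top)
  moreover have "integrable lborel (?p x)" for x
    using L2_mult_integrable[OF f L2_translate(1)[OF g, of "- x"]] by simp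
  ultimately have AE: "AE x in lborel. (\<integral>\<^sup>+\<xi>. (cmod (fourier (?p x) \<xi>))\<^sup>2 \<partial>lborel) = (\<integral>\<^sup>+t. (cmod (?p x t))\<^sup>2 \<partial>lborel)"
    by (auto intro: plancherel)
  have "(\<integral>\<^sup>+z. (cmod (stft g f z))\<^sup>2 \<partial>lborel) = (\<integral>\<^sup>+z. (cmod (stft g f z))\<^sup>2 \<partial>(lborel \<Otimes>\<^sub>M lborel))"
    by (simp add: lborel_prod)
  also have "\<dots> = (\<integral>\<^sup>+x. (\<integral>\<^sup>+\<xi>. (cmod (stft g f (x, \<xi>)))\<^sup>2 \<partial>lborel) \<partial>lborel)"
    by (rule lborel.nn_integral_fst[symmetric]) (simp add: lborel_prod)
  also have "\<dots> = (\<integral>\<^sup>+x. (\<integral>\<^sup>+t. (cmod (?p x t))\<^sup>2 \<partial>lborel) \<partial>lborel)"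
    using AE by (intro nn_integral_cong_AE) (simp add: stft_eq_fourier)
  finally show ?thesis by (simp only: *)
qed

lemma
  assumes "f \<in> L2 lborel" "g \<in> L2 lborel"
  shows stft_L2: "stft g f \<in> L2 lborel"
    and moyal: "L2_norm lborel (stft g f) = L2_norm lborel f * L2_norm lborel g"
proof -
  have [measurable]: "f \<in> borel_measurable borel" "g \<in> borel_measurable borel"
    using assms by (auto dest: L2_measurable)
  have "stft g f \<in> borel_measurable lborel" by simp
  then show "stft g f \<in> L2 lborel" "L2_norm lborel (stft g f) = L2_norm lborel f * L2_norm lborel g"
    using nn_integral_stft_square[OF assms] by (auto intro: L2_nn_integralI)
qed

text \<open>Time-frequency shifts form a group up to phase factors, so a correlation of two shifted functions
depends on the shifts only through their difference, up to a phase. This is why the kernels below are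
of convolution type.\<close>

lemma norm_inner_tf_shift:
  "cmod (L2_inner lborel (tf_shift z g) (tf_shift u \<phi>)) = cmod (stft \<phi> g (u - z))"
proof -
  obtain x \<xi> y \<eta> where zu: "z = (x, \<xi>)" "u = (y, \<eta>)" by (cases z, cases u)
  let ?e = "\<lambda>\<xi> t. exp (2 * of_real pi * \<i> * of_real \<xi> * of_real t) :: complex"
  have e: "?e \<xi> (x + t) * cnj (?e \<eta> (x + t)) = ?e (\<xi> - \<eta>) x * cnj (?e (\<eta> - \<xi>) t)" for t
    by (simp add: exp_cnj flip: exp_add) (simp add: algebra_simps)
  let ?F = "\<lambda>t. tf_shift z g t * cnj (tf_shift u \<phi> t)"
  have "L2_inner lborel (tf_shift z g) (tf_shift u \<phi>) = (\<integral>t. ?F (x + 1 * t) \<partial>lborel)"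
    unfolding L2_inner_def using lborel_integral_real_affine[of 1 ?F x] by simp
  also have "\<dots> = (\<integral>t. ?e (\<xi> - \<eta>) x * (g t * cnj (tf_shift (u - z) \<phi> t)) \<partial>lborel)"
  proof (rule Bochner_Integration.integral_cong[OF refl])
    fix t
    have "?F (x + 1 * t) = (?e \<xi> (x + t) * cnj (?e \<eta> (x + t))) * (g t * cnj (\<phi> (x + t - y)))"
      unfolding zu tf_shift_def by simp
    also have "\<dots> = ?e (\<xi> - \<eta>) x * (g t * cnj (tf_shift (u - z) \<phi> t))"
      unfolding e zu tf_shift_def by (simp add: algebra_simps)
    finally show "?F (x + 1 * t) = ?e (\<xi> - \<eta>) x * (g t * cnj (tf_shift (u - z) \<phi> t))" .
  qed
  also have "\<dots> = ?e (\<xi> - \<eta>) x * stft \<phi> g (u - z)"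
    unfolding stft_def L2_inner_def by (rule integral_mult_right_zero)
  finally show ?thesis by (simp add: norm_mult)
qed

text \<open>This is the adjoint of \<open>stft g\<close>, applied to an integrable \<open>G\<close>. For square-integrable \<open>g\<close> the integral
converges absolutely for almost every \<open>t\<close>; the value \<open>0\<close> on the exceptional null set is harmless.\<close>

definition synthesis :: "(real \<Rightarrow> complex) \<Rightarrow> (real \<times> real \<Rightarrow> complex) \<Rightarrow> real \<Rightarrow> complex" where
  "synthesis g G t = (\<integral>z. G z * tf_shift z g t \<partial>lborel)"

lemma norm_integral_le_nn_integral:
  fixes f :: "'a \<Rightarrow> 'b::{banach, second_countable_topology}"
  shows "ennreal (norm (integral\<^sup>L M f)) \<le> (\<integral>\<^sup>+x. norm (f x) \<partial>M)"
  by (cases "integrable M f") (auto simp: not_integrable_integral_eq intro: integral_norm_bound_ennreal)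

text \<open>Minkowski's inequality for a superposition of functions of equal norm, obtained from the
Cauchy-Schwarz inequality with respect to the finite measure \<open>\<bar>G z\<bar> dz\<close>.\<close>

lemma synthesis_L2:
  assumes G: "integrable lborel G" and g: "g \<in> L2 lborel"
  shows "synthesis g G \<in> L2 lborel"
proof -
  have [measurable]: "G \<in> borel_measurable borel" "g \<in> borel_measurable borel"
    using G g by (auto dest: L2_measurable borel_measurable_integrable)
  have fin: "(\<integral>\<^sup>+z. cmod (G z) \<partial>lborel) < \<infinity>" using G by (simp add: integrable_iff_bounded)
  let ?c = "\<lambda>z t. ennreal (cmod (G z)) * ennreal ((cmod (g (t - fst z)))\<^sup>2)"
  have pt: "ennreal ((cmod (synthesis g G t))\<^sup>2) \<le> (\<integral>\<^sup>+z. cmod (G z) \<partial>lborel) * (\<integral>\<^sup>+z. ?c z t \<partial>lborel)" for t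
  proof -
    let ?a = "\<lambda>z. ennreal (sqrt (cmod (G z)))" and ?b = "\<lambda>z. ennreal (sqrt (cmod (G z)) * cmod (g (t - fst z)))"
    have "ennreal (cmod (synthesis g G t)) \<le> (\<integral>\<^sup>+z. cmod (G z * tf_shift z g t) \<partial>lborel)"
      unfolding synthesis_def by (rule norm_integral_le_nn_integral)
    also have "\<dots> = (\<integral>\<^sup>+z. ?a z * ?b z \<partial>lborel)"
      by (intro nn_integral_cong) (simp add: norm_mult norm_tf_shift flip: ennreal_mult mult.assoc)
    finally have "(ennreal (cmod (synthesis g G t)))\<^sup>2 \<le> (\<integral>\<^sup>+z. ?a z * ?b z \<partial>lborel)\<^sup>2"
      by (rule power_mono) simp
    also have "\<dots> \<le> (\<integral>\<^sup>+z. (?a z)\<^sup>2 \<partial>lborel) * (\<integral>\<^sup>+z. (?b z)\<^sup>2 \<partial>lborel)"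
      by (rule Cauchy_Schwarz_nn_integral) auto
    finally show ?thesis
      by (simp add: ennreal_power power_mult_distrib ennreal_mult)
  qed
  have "(\<integral>\<^sup>+t. (cmod (synthesis g G t))\<^sup>2 \<partial>lborel) \<le> (\<integral>\<^sup>+t. (\<integral>\<^sup>+z. cmod (G z) \<partial>lborel) * (\<integral>\<^sup>+z. ?c z t \<partial>lborel) \<partial>lborel)"
    by (intro nn_integral_mono pt)
  also have "\<dots> = (\<integral>\<^sup>+z. cmod (G z) \<partial>lborel) * (\<integral>\<^sup>+t. (\<integral>\<^sup>+z. ?c z t \<partial>lborel) \<partial>lborel)"
    by (rule nn_integral_cmult) measurable
  also have "(\<integral>\<^sup>+t. (\<integral>\<^sup>+z. ?c z t \<partial>lborel) \<partial>lborel) = (\<integral>\<^sup>+z. (\<integral>\<^sup>+t. ?c z t \<partial>lborel) \<partial>lborel)"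
    by (rule lborel_pair.Fubini') measurable
  also have "\<dots> = (\<integral>\<^sup>+z. cmod (G z) * ennreal ((L2_norm lborel g)\<^sup>2) \<partial>lborel)"
  proof (rule nn_integral_cong)
    fix z :: "real \<times> real"
    have "(\<integral>\<^sup>+t. ?c z t \<partial>lborel) = cmod (G z) * (\<integral>\<^sup>+t. (cmod (tf_shift z g t))\<^sup>2 \<partial>lborel)"
      by (simp add: nn_integral_cmult norm_tf_shift)
    then show "(\<integral>\<^sup>+t. ?c z t \<partial>lborel) = cmod (G z) * ennreal ((L2_norm lborel g)\<^sup>2)"
      by (simp add: nn_integral_L2_norm tf_shift_L2 g)
  qed
  also have "\<dots> = (\<integral>\<^sup>+z. cmod (G z) \<partial>lborel) * ennreal ((L2_norm lborel g)\<^sup>2)"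
    by (rule nn_integral_multc) simp
  finally have "(\<integral>\<^sup>+t. (cmod (synthesis g G t))\<^sup>2 \<partial>lborel) < \<infinity>"
    by (rule le_less_trans) (use fin in \<open>simp add: ennreal_mult_less_top\<close>)
  moreover have "synthesis g G \<in> borel_measurable lborel"
    unfolding synthesis_def by measurable
  ultimately show ?thesis by (simp add: L2_iff_nn_integral)
qed

lemma synthesis_inner:
  assumes G: "integrable lborel G" and g: "g \<in> L2 lborel" and f: "f \<in> L2 lborel"
  shows "L2_inner lborel (synthesis g G) f = (\<integral>z. G z * L2_inner lborel (tf_shift z g) f \<partial>lborel)"
proof -
  have [measurable]: "G \<in> borel_measurable borel" "g \<in> borel_measurable borel" "f \<in> borel_measurable borel"
    using G g f by (auto dest: L2_measurable borel_measurable_integrable)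
  let ?k = "\<lambda>z t. G z * tf_shift z g t * cnj (f t)"
  have "(\<integral>\<^sup>+z. (\<integral>\<^sup>+t. cmod (?k z t) \<partial>lborel) \<partial>lborel) \<le> (\<integral>\<^sup>+z. cmod (G z) * ennreal (L2_norm lborel g * L2_norm lborel f) \<partial>lborel)"
  proof (rule nn_integral_mono)
    fix z :: "real \<times> real"
    have "(\<integral>\<^sup>+t. cmod (?k z t) \<partial>lborel) = cmod (G z) * (\<integral>\<^sup>+t. cmod (tf_shift z g t) * cmod (f t) \<partial>lborel)"
      by (subst nn_integral_cmult[symmetric]) (auto simp: norm_mult ennreal_mult mult_ac)
    also have "\<dots> \<le> cmod (G z) * ennreal (L2_norm lborel g * L2_norm lborel f)"
      using nn_integral_mult_L2_le[OF tf_shift_L2(1)[OF g] f, of z]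
      by (intro mult_left_mono) (simp_all add: tf_shift_L2(2)[OF g])
    finally show "(\<integral>\<^sup>+t. cmod (?k z t) \<partial>lborel) \<le> cmod (G z) * ennreal (L2_norm lborel g * L2_norm lborel f)" .
  qed
  also have "\<dots> = (\<integral>\<^sup>+z. cmod (G z) \<partial>lborel) * ennreal (L2_norm lborel g * L2_norm lborel f)"
    by (rule nn_integral_multc) simp
  also have "\<dots> < \<infinity>" using G by (simp add: integrable_iff_bounded ennreal_mult_less_top)
  finally have int: "integrable (lborel \<Otimes>\<^sub>M lborel) (\<lambda>(z, t). ?k z t)"
    by (simp add: integrable_iff_bounded lborel.nn_integral_fst[symmetric] split_beta')
  have "L2_inner lborel (synthesis g G) f = (\<integral>t. (\<integral>z. ?k z t \<partial>lborel) \<partial>lborel)"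
    unfolding L2_inner_def synthesis_def by simp
  also have "\<dots> = (\<integral>z. (\<integral>t. ?k z t \<partial>lborel) \<partial>lborel)"
    by (rule lborel_pair.Fubini_integral[OF int])
  also have "\<dots> = (\<integral>z. G z * L2_inner lborel (tf_shift z g) f \<partial>lborel)"
    unfolding L2_inner_def
  proof (rule Bochner_Integration.integral_cong[OF refl])
    fix z
    show "(\<integral>t. ?k z t \<partial>lborel) = G z * (\<integral>t. tf_shift z g t * cnj (f t) \<partial>lborel)"
      by (rule trans[OF _ integral_mult_right_zero]) (simp only: mult.assoc)
  qed
  finally show ?thesis .
qed

lemma synthesis_inner_stft:
  assumes "integrable lborel G" "g \<in> L2 lborel" "f \<in> L2 lborel"
  shows "L2_inner lborel (synthesis g G) f = L2_inner lborel G (stft g f)"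
  unfolding synthesis_inner[OF assms] L2_inner_def[of _ G] stft_def
  by (rule Bochner_Integration.integral_cong[OF refl]) (subst L2_inner_commute, rule refl)

text \<open>The bound is the convolution of \<open>\<bar>G\<bar>\<close> with \<open>\<bar>stft \<phi> g\<bar>\<close>, so the transform of a synthesised function is
localised near the support of \<open>G\<close> as well as \<open>stft \<phi> g\<close> is localised near \<open>0\<close>.\<close>

lemma norm_stft_synthesis_le:
  assumes "integrable lborel G" "g \<in> L2 lborel" "\<phi> \<in> L2 lborel"
  shows "ennreal (cmod (stft \<phi> (synthesis g G) u)) \<le> (\<integral>\<^sup>+z. cmod (G z) * cmod (stft \<phi> g (u - z)) \<partial>lborel)"
proof -
  have "stft \<phi> (synthesis g G) u = (\<integral>z. G z * L2_inner lborel (tf_shift z g) (tf_shift u \<phi>) \<partial>lborel)"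
    unfolding stft_def using assms by (intro synthesis_inner tf_shift_L2)
  then show ?thesis
    using norm_integral_le_nn_integral[of lborel "\<lambda>z. G z * L2_inner lborel (tf_shift z g) (tf_shift u \<phi>)"]
    by (simp add: norm_mult norm_inner_tf_shift)
qed

section \<open>Convolutions of functions with separated supports\<close>

text \<open>With \<open>m = \<bar>stft \<phi> g\<bar>\<close> this is the bound that Schur's test gives for the interaction of two sets at
distance at least \<open>r\<close>.\<close>

definition tail_correlation :: "('a::euclidean_space \<Rightarrow> ennreal) \<Rightarrow> real \<Rightarrow> ennreal" where
  "tail_correlation m r = (\<integral>\<^sup>+v. (\<integral>\<^sup>+u. m u * m (u + v) \<partial>lborel) * indicator {v. r \<le> norm v} v \<partial>lborel)"

text \<open>The integral of the whole correlation is the square of the integral of \<open>m\<close>, hence finite, and so its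
tails vanish in the limit.\<close>

lemma tail_correlation_tendsto_0:
  fixes m :: "'a::euclidean_space \<Rightarrow> ennreal"
  assumes [measurable]: "m \<in> borel_measurable borel" and fin: "(\<integral>\<^sup>+u. m u \<partial>lborel) < \<infinity>"
  shows "(\<lambda>n. tail_correlation m (real n)) \<longlonglongrightarrow> 0"
proof -
  let ?k = "\<lambda>v. \<integral>\<^sup>+u. m u * m (u + v) \<partial>lborel"
  have "(\<integral>\<^sup>+v. ?k v \<partial>lborel) = (\<integral>\<^sup>+u. (\<integral>\<^sup>+v. m u * m (u + v) \<partial>lborel) \<partial>lborel)"
    by (rule lborel_pair.Fubini') measurable
  also have "\<dots> = (\<integral>\<^sup>+u. m u * (\<integral>\<^sup>+v. m v \<partial>lborel) \<partial>lborel)"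
    using nn_integral_lborel_shift[of m] by (simp add: nn_integral_cmult add.commute)
  also have "\<dots> = (\<integral>\<^sup>+u. m u \<partial>lborel) * (\<integral>\<^sup>+v. m v \<partial>lborel)"
    by (rule nn_integral_multc) simp
  also have "\<dots> < \<infinity>" using fin by (simp add: ennreal_mult_less_top)
  finally have kfin: "(\<integral>\<^sup>+v. ?k v \<partial>lborel) < \<infinity>" .
  have "(\<lambda>n. tail_correlation m (real n)) \<longlonglongrightarrow> (\<integral>\<^sup>+v. 0 \<partial>(lborel :: 'a measure))"
    unfolding tail_correlation_def
  proof (rule nn_integral_dominated_convergence[OF _ _ _ _ kfin])
    show "AE v in lborel. (\<lambda>n. ?k v * indicator {v. real n \<le> norm v} v) \<longlonglongrightarrow> 0"
    proof (rule AE_I2, rule tendsto_eventually)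
      fix v :: 'a
      obtain N where "norm v < real N" using reals_Archimedean2 by blast
      then have "\<forall>n\<ge>N. \<not> real n \<le> norm v" by (meson le_less_trans not_le of_nat_le_iff order_trans)
      then show "\<forall>\<^sub>F n in sequentially. ?k v * indicator {v. real n \<le> norm v} v = 0"
        unfolding eventually_sequentially by (intro exI[of _ N]) auto
    qed
    show "AE v in lborel. ?k v * indicator {v. real n \<le> norm v} v \<le> ?k v" for n
      by (auto simp: indicator_def)
  qed auto
  then show ?thesis by simp
qed

text \<open>By Tonelli's theorem the left side is a double integral of \<open>a z * b w\<close> against the correlation of \<open>m\<close> at
\<open>z - w\<close>, and only pairs with \<open>norm (z - w) \<ge> r\<close> contribute. Bounding \<open>2 * a z * b w\<close> by the sum of the
squares separates the two variables; in each of the two terms the other variable can be integrated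
out and yields the tail.\<close>

lemma separated_convolutions_almost_orthogonal:
  fixes a b m :: "'a::euclidean_space \<Rightarrow> ennreal"
  assumes [measurable]: "a \<in> borel_measurable borel" "b \<in> borel_measurable borel" "m \<in> borel_measurable borel"
    and sep: "\<And>z w. a z \<noteq> 0 \<Longrightarrow> b w \<noteq> 0 \<Longrightarrow> r \<le> norm (z - w)"
  shows "2 * (\<integral>\<^sup>+u. (\<integral>\<^sup>+z. a z * m (u - z) \<partial>lborel) * (\<integral>\<^sup>+w. b w * m (u - w) \<partial>lborel) \<partial>lborel)
    \<le> tail_correlation m r * ((\<integral>\<^sup>+z. (a z)\<^sup>2 \<partial>lborel) + (\<integral>\<^sup>+w. (b w)\<^sup>2 \<partial>lborel))"
proof -
  define k where "k = (\<lambda>v. (\<integral>\<^sup>+u. m u * m (u + v) \<partial>lborel) * indicator {v. r \<le> norm v} v)"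
  have [measurable]: "k \<in> borel_measurable borel" unfolding k_def by measurable
  have "(\<integral>\<^sup>+u. (\<integral>\<^sup>+z. a z * m (u - z) \<partial>lborel) * (\<integral>\<^sup>+w. b w * m (u - w) \<partial>lborel) \<partial>lborel)
     = (\<integral>\<^sup>+u. (\<integral>\<^sup>+z. (\<integral>\<^sup>+w. a z * b w * (m (u - z) * m (u - w)) \<partial>lborel) \<partial>lborel) \<partial>lborel)"
  proof (rule nn_integral_cong)
    fix u
    have "(\<integral>\<^sup>+z. a z * m (u - z) \<partial>lborel) * (\<integral>\<^sup>+w. b w * m (u - w) \<partial>lborel)
      = (\<integral>\<^sup>+z. (\<integral>\<^sup>+w. (a z * m (u - z)) * (b w * m (u - w)) \<partial>lborel) \<partial>lborel)"
      by (simp add: nn_integral_multc nn_integral_cmult)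
    then show "(\<integral>\<^sup>+z. a z * m (u - z) \<partial>lborel) * (\<integral>\<^sup>+w. b w * m (u - w) \<partial>lborel)
      = (\<integral>\<^sup>+z. (\<integral>\<^sup>+w. a z * b w * (m (u - z) * m (u - w)) \<partial>lborel) \<partial>lborel)"
      by (simp only: mult_ac)
  qed
  also have "\<dots> = (\<integral>\<^sup>+z. (\<integral>\<^sup>+u. (\<integral>\<^sup>+w. a z * b w * (m (u - z) * m (u - w)) \<partial>lborel) \<partial>lborel) \<partial>lborel)"
    by (rule lborel_pair.Fubini') measurable
  also have "\<dots> = (\<integral>\<^sup>+z. (\<integral>\<^sup>+w. (\<integral>\<^sup>+u. a z * b w * (m (u - z) * m (u - w)) \<partial>lborel) \<partial>lborel) \<partial>lborel)"
    by (intro nn_integral_cong lborel_pair.Fubini') measurable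
  also have "\<dots> = (\<integral>\<^sup>+z. (\<integral>\<^sup>+w. a z * b w * k (z - w) \<partial>lborel) \<partial>lborel)"
  proof (intro nn_integral_cong)
    fix z w
    have "(\<integral>\<^sup>+u. m (u - z) * m (u - w) \<partial>lborel) = (\<integral>\<^sup>+u. m u * m (u + (z - w)) \<partial>lborel)"
      using nn_integral_lborel_shift[of "\<lambda>u. m (u - z) * m (u - w)" z] by (simp add: algebra_simps)
    then have "a z * b w * (\<integral>\<^sup>+u. m (u - z) * m (u - w) \<partial>lborel) = a z * b w * k (z - w)"
      using sep[of z w] by (cases "a z = 0 \<or> b w = 0") (auto simp: k_def)
    then show "(\<integral>\<^sup>+u. a z * b w * (m (u - z) * m (u - w)) \<partial>lborel) = a z * b w * k (z - w)"
      by (simp add: nn_integral_cmult)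
  qed
  finally have "2 * (\<integral>\<^sup>+u. (\<integral>\<^sup>+z. a z * m (u - z) \<partial>lborel) * (\<integral>\<^sup>+w. b w * m (u - w) \<partial>lborel) \<partial>lborel)
     = (\<integral>\<^sup>+z. (\<integral>\<^sup>+w. 2 * (a z * b w * k (z - w)) \<partial>lborel) \<partial>lborel)"
    by (simp add: nn_integral_cmult)
  also have "\<dots> \<le> (\<integral>\<^sup>+z. (\<integral>\<^sup>+w. (a z)\<^sup>2 * k (z - w) + (b w)\<^sup>2 * k (z - w) \<partial>lborel) \<partial>lborel)"
  proof (intro nn_integral_mono)
    fix z w
    have "2 * (a z * b w * k (z - w)) = (2 * a z * b w) * k (z - w)" by (simp add: mult_ac)
    also have "\<dots> \<le> ((a z)\<^sup>2 + (b w)\<^sup>2) * k (z - w)"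
      by (intro mult_right_mono sum_of_squares_ge_ennreal) simp
    finally show "2 * (a z * b w * k (z - w)) \<le> (a z)\<^sup>2 * k (z - w) + (b w)\<^sup>2 * k (z - w)"
      by (simp add: distrib_right)
  qed
  also have "\<dots> = (\<integral>\<^sup>+z. (\<integral>\<^sup>+w. (a z)\<^sup>2 * k (z - w) \<partial>lborel) \<partial>lborel) + (\<integral>\<^sup>+z. (\<integral>\<^sup>+w. (b w)\<^sup>2 * k (z - w) \<partial>lborel) \<partial>lborel)"
    by (simp add: nn_integral_add)
  also have "(\<integral>\<^sup>+z. (\<integral>\<^sup>+w. (b w)\<^sup>2 * k (z - w) \<partial>lborel) \<partial>lborel) = (\<integral>\<^sup>+w. (\<integral>\<^sup>+z. (b w)\<^sup>2 * k (z - w) \<partial>lborel) \<partial>lborel)"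
    by (rule lborel_pair.Fubini') measurable
  also have "\<dots> = (\<integral>\<^sup>+w. (b w)\<^sup>2 * tail_correlation m r \<partial>lborel)"
  proof (rule nn_integral_cong)
    fix w
    have "(\<integral>\<^sup>+z. k (z - w) \<partial>lborel) = tail_correlation m r"
      using nn_integral_lborel_shift[of k "- w"] by (simp add: k_def tail_correlation_def)
    then show "(\<integral>\<^sup>+z. (b w)\<^sup>2 * k (z - w) \<partial>lborel) = (b w)\<^sup>2 * tail_correlation m r"
      by (simp add: nn_integral_cmult)
  qed
  also have "(\<integral>\<^sup>+z. (\<integral>\<^sup>+w. (a z)\<^sup>2 * k (z - w) \<partial>lborel) \<partial>lborel) = (\<integral>\<^sup>+z. (a z)\<^sup>2 * tail_correlation m r \<partial>lborel)"
  proof (rule nn_integral_cong)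
    fix z
    have "(\<integral>\<^sup>+w. k (z - w) \<partial>lborel) = tail_correlation m r"
      using nn_integral_lborel_reflect[of k z] by (simp add: k_def tail_correlation_def)
    then show "(\<integral>\<^sup>+w. (a z)\<^sup>2 * k (z - w) \<partial>lborel) = (a z)\<^sup>2 * tail_correlation m r"
      by (simp add: nn_integral_cmult)
  qed
  also have "(\<integral>\<^sup>+z. (a z)\<^sup>2 * tail_correlation m r \<partial>lborel) + (\<integral>\<^sup>+w. (b w)\<^sup>2 * tail_correlation m r \<partial>lborel)
      = tail_correlation m r * ((\<integral>\<^sup>+z. (a z)\<^sup>2 \<partial>lborel) + (\<integral>\<^sup>+w. (b w)\<^sup>2 \<partial>lborel))"
    by (simp add: nn_integral_multc distrib_right mult.commute[of "tail_correlation m r"])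
  finally show ?thesis .
qed

lemma stft_sum:
  assumes "\<And>k. k \<in> I \<Longrightarrow> h k \<in> L2 lborel" "\<phi> \<in> L2 lborel"
  shows "stft \<phi> (\<lambda>t. \<Sum>k\<in>I. h k t) u = (\<Sum>k\<in>I. stft \<phi> (h k) u)"
  unfolding stft_def by (intro L2_inner_sum_left assms tf_shift_L2)

section \<open>Concentration as a best constant\<close>

lemma L2_norm_indicator_le:
  assumes "f \<in> L2 M" "A \<in> sets M" "B \<in> sets M" "A \<subseteq> B"
  shows "L2_norm M (\<lambda>z. f z * indicator A z) \<le> L2_norm M (\<lambda>z. f z * indicator B z)"
proof -
  have "(\<lambda>z. f z * indicator A z) \<in> L2 M" "(\<lambda>z. f z * indicator B z) \<in> L2 M"
    using assms by (auto intro: L2_mult_indicator)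
  then show ?thesis
    unfolding L2_norm_def using assms(4)
    by (intro real_sqrt_le_mono integral_mono) (auto simp: L2_def indicator_def)
qed

lemma L2_norm_restrict_le:
  assumes "f \<in> L2 M" "A \<in> sets M"
  shows "L2_norm M (\<lambda>z. f z * indicator A z) \<le> L2_norm M f"
proof -
  have "L2_norm M (\<lambda>z. f z * indicator A z) \<le> L2_norm M (\<lambda>z. f z * indicator (space M) z)"
    using assms sets.sets_into_space by (intro L2_norm_indicator_le) auto
  also have "\<dots> = L2_norm M f"
    unfolding L2_norm_def by (intro arg_cong[where f=sqrt] Bochner_Integration.integral_cong) auto
  finally show ?thesis .
qed

text \<open>The quotients are bounded by \<open>1\<close>, so their supremum is a true upper bound; if the transform has norm \<open>0\<close>,
both sides vanish.\<close>

lemma concentration_upper: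
  assumes g: "g \<in> L2 lborel" and A: "A \<in> sets borel" and f: "f \<in> L2 lborel"
  shows "L2_norm lborel (\<lambda>z. stft g f z * indicator A z) \<le> concentration g A * L2_norm lborel (stft g f)"
proof -
  let ?q = "\<lambda>f. L2_norm lborel (\<lambda>z. stft g f z * indicator A z) / L2_norm lborel (stft g f)"
  have le: "L2_norm lborel (\<lambda>z. stft g f z * indicator A z) \<le> L2_norm lborel (stft g f)" if "f \<in> L2 lborel" for f
    using that g A by (intro L2_norm_restrict_le stft_L2) auto
  have "bdd_above (?q ` L2 lborel)"
    by (rule bdd_aboveI2[where M=1]) (simp add: le divide_le_eq_1 less_le)
  then have "?q f \<le> concentration g A"
    unfolding concentration_def by (intro cSUP_upper f)
  then show ?thesis
    using le[OF f] L2_norm_nonneg[of lborel "stft g f"] 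
    by (cases "L2_norm lborel (stft g f) = 0") (auto simp: divide_le_eq less_le)
qed

lemma concentration_least:
  assumes "0 \<le> c"
    and "\<And>f. f \<in> L2 lborel \<Longrightarrow> L2_norm lborel (\<lambda>z. stft g f z * indicator A z) \<le> c * L2_norm lborel (stft g f)"
  shows "concentration g A \<le> c"
  unfolding concentration_def
proof (rule cSUP_least)
  show "L2 lborel \<noteq> ({} :: (real \<Rightarrow> complex) set)" using L2_zero by blast
  fix f :: "real \<Rightarrow> complex" assume "f \<in> L2 lborel"
  from assms(2)[OF this] show "L2_norm lborel (\<lambda>z. stft g f z * indicator A z) / L2_norm lborel (stft g f) \<le> c"
    using assms(1) L2_norm_nonneg[of lborel "stft g f"]
    by (cases "L2_norm lborel (stft g f) = 0") (auto simp: divide_le_eq less_le)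
qed

lemma concentration_nonneg:
  assumes g: "g \<in> L2 lborel" and A: "A \<in> sets borel"
  shows "0 \<le> concentration g A"
proof (rule ccontr)
  assume neg: "\<not> 0 \<le> concentration g A"
  \<comment> \<open>A negative constant in the upper bound forces all transforms to have norm \<open>0\<close>, and then the
    supremum is taken over zeros only.\<close>
  have "L2_norm lborel (stft g f) = 0" if f: "f \<in> L2 lborel" for f
    using concentration_upper[OF g A f] neg L2_norm_nonneg[of lborel "stft g f"]
      L2_norm_nonneg[of lborel "\<lambda>z. stft g f z * indicator A z"]
    by (smt (verit) mult_neg_pos)
  then have "concentration g A = (SUP f\<in>L2 lborel :: (real \<Rightarrow> complex) set. 0)"
    unfolding concentration_def by (intro SUP_cong) auto
  moreover have "L2 lborel \<noteq> ({} :: (real \<Rightarrow> complex) set)" using L2_zero by blast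
  ultimately show False using neg by simp
qed

lemma concentration_mono:
  assumes g: "g \<in> L2 lborel" and "A \<in> sets borel" "B \<in> sets borel" "A \<subseteq> B"
  shows "concentration g A \<le> concentration g B"
proof (rule concentration_least)
  show "0 \<le> concentration g B" by (rule concentration_nonneg) fact+
  fix f :: "real \<Rightarrow> complex" assume f: "f \<in> L2 lborel"
  have "L2_norm lborel (\<lambda>z. stft g f z * indicator A z) \<le> L2_norm lborel (\<lambda>z. stft g f z * indicator B z)"
    using assms by (intro L2_norm_indicator_le stft_L2 f) auto
  also have "\<dots> \<le> concentration g B * L2_norm lborel (stft g f)"
    by (rule concentration_upper) fact+
  finally show "L2_norm lborel (\<lambda>z. stft g f z * indicator A z) \<le> concentration g B * L2_norm lborel (stft g f)" .
qed

section \<open>Unions of separated sets\<close>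

lemma norm_sum_square_le:
  fixes v :: "'k \<Rightarrow> 'a::real_normed_vector"
  assumes "finite I"
  shows "(norm (\<Sum>k\<in>I. v k))\<^sup>2 \<le> (\<Sum>k\<in>I. (norm (v k))\<^sup>2) + (\<Sum>k\<in>I. \<Sum>l\<in>I - {k}. norm (v k) * norm (v l))"
proof -
  have "(norm (\<Sum>k\<in>I. v k))\<^sup>2 \<le> (\<Sum>k\<in>I. norm (v k))\<^sup>2"
    by (intro power_mono norm_sum) simp
  also have "\<dots> = (\<Sum>k\<in>I. \<Sum>l\<in>I. norm (v k) * norm (v l))"
    by (simp add: power2_eq_square sum_product)
  also have "\<dots> = (\<Sum>k\<in>I. (norm (v k))\<^sup>2 + (\<Sum>l\<in>I - {k}. norm (v k) * norm (v l)))"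
    using assms by (intro sum.cong refl) (simp add: sum.remove power2_eq_square)
  finally show ?thesis by (simp add: sum.distrib)
qed

text \<open>With \<open>h = synthesis g G\<close>, adjointness gives \<open>\<parallel>h\<parallel>\<^sup>2\<close> as the inner product of \<open>G\<close> with the restriction of
\<open>stft g h\<close> to \<open>A\<close>, because \<open>G\<close> already vanishes outside \<open>A\<close>. The definition of the concentration, applied
to \<open>h\<close> itself, and Moyal's identity bound it by a multiple of \<open>\<parallel>G\<parallel> \<parallel>h\<parallel>\<close>. This is the estimate for a
diagonal block.\<close>

lemma norm_synthesis_restricted_stft_le:
  assumes g: "g \<in> L2 lborel" and f: "f \<in> L2 lborel" and A: "A \<in> fmeasurable lborel"
  defines "G \<equiv> \<lambda>z. stft g f z * indicator A z"
  shows "integrable lborel G" "G \<in> L2 lborel"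
    and "L2_norm lborel (synthesis g G) \<le> concentration g A * L2_norm lborel g * L2_norm lborel G"
    and "L2_inner lborel (synthesis g G) f = of_real ((L2_norm lborel G)\<^sup>2)"
proof -
  have A': "A \<in> sets lborel" "A \<in> sets borel" using A by (auto simp: fmeasurable_def)
  have F: "stft g f \<in> L2 lborel" by (rule stft_L2[OF f g])
  then show G2: "G \<in> L2 lborel" unfolding G_def by (rule L2_mult_indicator[OF _ A'(1)])
  have "integrable lborel (indicator A :: real \<times> real \<Rightarrow> real)"
    using A by (auto simp: fmeasurable_def)
  moreover have "(cmod (indicator A z))\<^sup>2 = indicator A z" for z
    by (simp add: indicator_def)
  ultimately have "(indicator A :: real \<times> real \<Rightarrow> complex) \<in> L2 lborel"
    using A' by (simp add: L2_def)
  moreover have "cnj (indicator A z) = indicator A z" for z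
    by (simp add: indicator_def)
  ultimately show G1: "integrable lborel G"
    using L2_mult_integrable[OF F, of "indicator A"] by (simp add: G_def)
  have inner: "L2_inner lborel (synthesis g G) h = L2_inner lborel G (\<lambda>z. stft g h z * indicator A z)"
    if "h \<in> L2 lborel" for h
    unfolding synthesis_inner_stft[OF G1 g that]
    unfolding L2_inner_def
    by (intro Bochner_Integration.integral_cong refl) (auto simp: G_def indicator_def)
  show "L2_inner lborel (synthesis g G) f = of_real ((L2_norm lborel G)\<^sup>2)"
    unfolding inner[OF f] by (fold G_def) (rule L2_inner_self)
  let ?h = "synthesis g G"
  have h: "?h \<in> L2 lborel" by (rule synthesis_L2[OF G1 g])
  have "(L2_norm lborel ?h)\<^sup>2 = cmod (L2_inner lborel ?h ?h)"
    unfolding L2_inner_self by (simp add: norm_power)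
  also have "\<dots> \<le> L2_norm lborel G * L2_norm lborel (\<lambda>z. stft g ?h z * indicator A z)"
    unfolding inner[OF h] by (intro L2_Cauchy_Schwarz G2 L2_mult_indicator stft_L2 h g A')
  also have "\<dots> \<le> L2_norm lborel G * (concentration g A * L2_norm lborel (stft g ?h))"
    by (intro mult_left_mono concentration_upper g A' h) simp
  also have "\<dots> = (concentration g A * L2_norm lborel g * L2_norm lborel G) * L2_norm lborel ?h"
    by (simp add: moyal[OF h g])
  finally have *: "L2_norm lborel ?h * L2_norm lborel ?h \<le> (concentration g A * L2_norm lborel g * L2_norm lborel G) * L2_norm lborel ?h"
    by (simp add: power2_eq_square)
  show "L2_norm lborel ?h \<le> concentration g A * L2_norm lborel g * L2_norm lborel G"
  proof (cases "L2_norm lborel ?h = 0")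
    case True
    then show ?thesis using concentration_nonneg[OF g A'(2)] by simp
  next
    case False
    then have "0 < L2_norm lborel ?h" using L2_norm_nonneg[of lborel ?h] by linarith
    with * show ?thesis by simp
  qed
qed

text \<open>Applying \<open>stft \<phi>\<close> multiplies all norms by \<open>\<parallel>\<phi>\<parallel>\<close>. In the expansion of the square of the transformed sum,
the diagonal terms give the squared norms of the summands, and the mixed terms are integrals of
products of convolutions of functions whose supports are \<open>r\<close> apart.\<close>

lemma norm_sum_synthesis_le:
  fixes G :: "'k \<Rightarrow> real \<times> real \<Rightarrow> complex"
  assumes I: "finite I" and g: "g \<in> L2 lborel" and \<phi>: "\<phi> \<in> L2 lborel"
    and G1: "\<And>k. k \<in> I \<Longrightarrow> integrable lborel (G k)" and G2: "\<And>k. k \<in> I \<Longrightarrow> G k \<in> L2 lborel"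
    and sep: "\<And>k l z w. \<lbrakk>k \<in> I; l \<in> I; k \<noteq> l; G k z \<noteq> 0; G l w \<noteq> 0\<rbrakk> \<Longrightarrow> r \<le> dist z w"
    and tail: "tail_correlation (\<lambda>v. ennreal (cmod (stft \<phi> g v))) r \<le> ennreal T" and T: "0 \<le> T"
  shows "(L2_norm lborel \<phi>)\<^sup>2 * (L2_norm lborel (\<lambda>t. \<Sum>k\<in>I. synthesis g (G k) t))\<^sup>2
    \<le> (\<Sum>k\<in>I. (L2_norm lborel \<phi>)\<^sup>2 * (L2_norm lborel (synthesis g (G k)))\<^sup>2)
       + real (card I) * T * (\<Sum>k\<in>I. (L2_norm lborel (G k))\<^sup>2)"
proof -
  let ?h = "\<lambda>k. synthesis g (G k)" and ?H = "\<lambda>t. \<Sum>k\<in>I. synthesis g (G k) t"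
  define V where "V = (\<lambda>k. stft \<phi> (?h k))"
  define m where "m = (\<lambda>v. ennreal (cmod (stft \<phi> g v)))"
  define S where "S = (\<lambda>k. (L2_norm lborel (G k))\<^sup>2)"
  have h: "?h k \<in> L2 lborel" if "k \<in> I" for k
    by (rule synthesis_L2[OF G1[OF that] g])
  have H: "?H \<in> L2 lborel" by (rule L2_sum[OF h])
  have [measurable]: "g \<in> borel_measurable borel" "\<phi> \<in> borel_measurable borel"
    using g \<phi> by (auto dest: L2_measurable)
  have [measurable]: "m \<in> borel_measurable borel" unfolding m_def by measurable
  have Vm [measurable]: "V k \<in> borel_measurable borel" if "k \<in> I" for k
    unfolding V_def using L2_measurable[OF h[OF that]] by measurable
  have cross: "(\<integral>\<^sup>+u. ennreal (cmod (V k u) * cmod (V l u)) \<partial>lborel) \<le> ennreal (T * (S k + S l) / 2)"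
    if kl: "k \<in> I" "l \<in> I" "k \<noteq> l" for k l
  proof -
    have [measurable]: "G k \<in> borel_measurable borel" "G l \<in> borel_measurable borel"
      using L2_measurable[OF G2[OF kl(1)]] L2_measurable[OF G2[OF kl(2)]] by simp_all
    let ?conv = "\<lambda>k u. \<integral>\<^sup>+z. ennreal (cmod (G k z)) * m (u - z) \<partial>lborel"
    have bound: "ennreal (cmod (V k u)) \<le> ?conv k u" if "k \<in> I" for k u
      unfolding V_def m_def using norm_stft_synthesis_le[OF G1[OF that] g \<phi>, of u] by (simp add: ennreal_mult)
    have "2 * (\<integral>\<^sup>+u. ennreal (cmod (V k u) * cmod (V l u)) \<partial>lborel) \<le> 2 * (\<integral>\<^sup>+u. ?conv k u * ?conv l u \<partial>lborel)"
      using bound kl by (intro mult_left_mono nn_integral_mono) (auto simp: ennreal_mult intro!: mult_mono)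
    also have "\<dots> \<le> tail_correlation m r * ((\<integral>\<^sup>+z. (ennreal (cmod (G k z)))\<^sup>2 \<partial>lborel) + (\<integral>\<^sup>+z. (ennreal (cmod (G l z)))\<^sup>2 \<partial>lborel))"
      using sep[OF kl] by (intro separated_convolutions_almost_orthogonal) (auto simp: dist_norm)
    also have "\<dots> \<le> ennreal T * (ennreal (S k) + ennreal (S l))"
      using tail kl by (intro mult_mono) (simp_all add: m_def S_def ennreal_power nn_integral_L2_norm G2)
    also have "\<dots> = ennreal (2 * (T * (S k + S l) / 2))"
      using T by (simp add: S_def ennreal_mult flip: ennreal_plus)
    also have "\<dots> = 2 * ennreal (T * (S k + S l) / 2)"
      using T by (subst ennreal_mult) (auto simp: S_def)
    finally show ?thesis
      by (simp add: ennreal_mult_le_mult_iff)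
  qed
  have "ennreal ((L2_norm lborel \<phi>)\<^sup>2 * (L2_norm lborel ?H)\<^sup>2) = (\<integral>\<^sup>+u. (cmod (stft \<phi> ?H u))\<^sup>2 \<partial>lborel)"
    using nn_integral_stft_square[OF H \<phi>] by (simp add: power_mult_distrib mult.commute)
  also have "\<dots> \<le> (\<integral>\<^sup>+u. (\<Sum>k\<in>I. ennreal ((cmod (V k u))\<^sup>2)) + (\<Sum>k\<in>I. \<Sum>l\<in>I - {k}. ennreal (cmod (V k u) * cmod (V l u))) \<partial>lborel)"
  proof (rule nn_integral_mono)
    fix u
    have "(cmod (stft \<phi> ?H u))\<^sup>2 \<le> (\<Sum>k\<in>I. (cmod (V k u))\<^sup>2) + (\<Sum>k\<in>I. \<Sum>l\<in>I - {k}. cmod (V k u) * cmod (V l u))"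
      unfolding V_def using norm_sum_square_le[OF I] by (simp add: stft_sum[OF h \<phi>])
    then have "ennreal ((cmod (stft \<phi> ?H u))\<^sup>2) \<le> ennreal ((\<Sum>k\<in>I. (cmod (V k u))\<^sup>2) + (\<Sum>k\<in>I. \<Sum>l\<in>I - {k}. cmod (V k u) * cmod (V l u)))"
      by (rule ennreal_leI)
    also have "\<dots> = (\<Sum>k\<in>I. ennreal ((cmod (V k u))\<^sup>2)) + (\<Sum>k\<in>I. \<Sum>l\<in>I - {k}. ennreal (cmod (V k u) * cmod (V l u)))"
      by (simp add: ennreal_plus sum_nonneg sum_ennreal)
    finally show "ennreal ((cmod (stft \<phi> ?H u))\<^sup>2) \<le> \<dots>" .
  qed
  also have "\<dots> = (\<Sum>k\<in>I. \<integral>\<^sup>+u. ennreal ((cmod (V k u))\<^sup>2) \<partial>lborel)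
      + (\<Sum>k\<in>I. \<Sum>l\<in>I - {k}. \<integral>\<^sup>+u. ennreal (cmod (V k u) * cmod (V l u)) \<partial>lborel)"
  proof -
    have "(\<integral>\<^sup>+u. (\<Sum>k\<in>I. \<Sum>l\<in>I - {k}. ennreal (cmod (V k u) * cmod (V l u))) \<partial>lborel)
        = (\<Sum>k\<in>I. \<integral>\<^sup>+u. (\<Sum>l\<in>I - {k}. ennreal (cmod (V k u) * cmod (V l u))) \<partial>lborel)"
      by (rule nn_integral_sum) auto
    also have "\<dots> = (\<Sum>k\<in>I. \<Sum>l\<in>I - {k}. \<integral>\<^sup>+u. ennreal (cmod (V k u) * cmod (V l u)) \<partial>lborel)"
      by (intro sum.cong refl nn_integral_sum) auto
    finally show ?thesis
      by (simp add: nn_integral_add nn_integral_sum del: sum_ennreal)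
  qed
  also have "\<dots> \<le> (\<Sum>k\<in>I. ennreal ((L2_norm lborel \<phi>)\<^sup>2 * (L2_norm lborel (?h k))\<^sup>2))
      + (\<Sum>k\<in>I. \<Sum>l\<in>I - {k}. ennreal (T * (S k + S l) / 2))"
    unfolding V_def[symmetric]
  proof (intro add_mono sum_mono)
    fix k assume "k \<in> I"
    then show "(\<integral>\<^sup>+u. ennreal ((cmod (V k u))\<^sup>2) \<partial>lborel) \<le> ennreal ((L2_norm lborel \<phi>)\<^sup>2 * (L2_norm lborel (?h k))\<^sup>2)"
      unfolding V_def using nn_integral_stft_square[OF h \<phi>, of k] by (simp add: power_mult_distrib mult.commute)
  next
    fix k l assume "k \<in> I" "l \<in> I - {k}"
    then show "(\<integral>\<^sup>+u. ennreal (cmod (V k u) * cmod (V l u)) \<partial>lborel) \<le> ennreal (T * (S k + S l) / 2)"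
      by (intro cross) auto
  qed
  also have "\<dots> = ennreal ((\<Sum>k\<in>I. (L2_norm lborel \<phi>)\<^sup>2 * (L2_norm lborel (?h k))\<^sup>2)
      + (\<Sum>k\<in>I. \<Sum>l\<in>I - {k}. T * (S k + S l) / 2))"
    using T by (simp add: ennreal_plus sum_nonneg sum_ennreal S_def)
  finally have "(L2_norm lborel \<phi>)\<^sup>2 * (L2_norm lborel ?H)\<^sup>2 \<le> (\<Sum>k\<in>I. (L2_norm lborel \<phi>)\<^sup>2 * (L2_norm lborel (?h k))\<^sup>2)
      + (\<Sum>k\<in>I. \<Sum>l\<in>I - {k}. T * (S k + S l) / 2)"
    by (subst (asm) ennreal_le_iff) (use T in \<open>auto simp: S_def intro!: add_nonneg_nonneg sum_nonneg\<close>)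
  \<comment> \<open>Readmitting the diagonal replaces the factor \<open>card I - 1\<close> by \<open>card I\<close> and decouples the two sums.\<close>
  also have "(\<Sum>k\<in>I. \<Sum>l\<in>I - {k}. T * (S k + S l) / 2) \<le> (\<Sum>k\<in>I. \<Sum>l\<in>I. T * (S k + S l) / 2)"
    using T I by (intro sum_mono sum_mono2) (auto simp: S_def)
  also have "\<dots> = real (card I) * T * (\<Sum>k\<in>I. S k)"
  proof -
    have "(\<Sum>k\<in>I. \<Sum>l\<in>I. S k + S l) = 2 * real (card I) * (\<Sum>k\<in>I. S k)"
      by (simp add: sum.distrib flip: sum_distrib_left)
    then have "T / 2 * (\<Sum>k\<in>I. \<Sum>l\<in>I. S k + S l) = real (card I) * T * (\<Sum>k\<in>I. S k)" by simp
    then show ?thesis by (simp add: sum_distrib_left)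
  qed
  finally show ?thesis by (simp add: S_def)
qed

text \<open>Let \<open>S\<close> be the squared norm of \<open>stft g f\<close> on the union and \<open>H\<close> the sum of the synthesised pieces.
Adjointness gives \<open>S \<le> \<parallel>H\<parallel> \<parallel>f\<parallel>\<close>, and the two preceding lemmas bound \<open>\<parallel>H\<parallel>\<^sup>2\<close> by a constant times
\<open>S\<close>. Cancelling one factor \<open>S\<close> leaves the claim, by Moyal's identity.\<close>

lemma concentration_separated_UN_le:
  fixes A :: "'k \<Rightarrow> (real \<times> real) set"
  assumes I: "finite I" and g: "g \<in> L2 lborel" and \<phi>: "\<phi> \<in> L2 lborel" and pos: "0 < L2_norm lborel g" "0 < L2_norm lborel \<phi>"
    and A: "\<And>k. k \<in> I \<Longrightarrow> A k \<in> fmeasurable lborel" and disj: "disjoint_family_on A I"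
    and sep: "\<And>k l z w. \<lbrakk>k \<in> I; l \<in> I; k \<noteq> l; z \<in> A k; w \<in> A l\<rbrakk> \<Longrightarrow> r \<le> dist z w"
    and tail: "tail_correlation (\<lambda>v. ennreal (cmod (stft \<phi> g v))) r \<le> ennreal T" and T: "0 \<le> T"
    and c: "\<And>k. k \<in> I \<Longrightarrow> concentration g (A k) \<le> c" and c0: "0 \<le> c"
  shows "concentration g (\<Union>k\<in>I. A k) \<le> sqrt (c\<^sup>2 + real (card I) * T / (L2_norm lborel g * L2_norm lborel \<phi>)\<^sup>2)"
    (is "_ \<le> sqrt ?b")
proof (rule concentration_least)
  have b0: "0 \<le> ?b" using T c0 by simp
  then show "0 \<le> sqrt ?b" by simp
  fix f :: "real \<Rightarrow> complex" assume f: "f \<in> L2 lborel"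
  define G where "G k = (\<lambda>z. stft g f z * indicator (A k) z)" for k
  let ?h = "\<lambda>k. synthesis g (G k)" and ?H = "\<lambda>t. \<Sum>k\<in>I. synthesis g (G k) t"
  let ?g = "L2_norm lborel g" and ?\<phi> = "L2_norm lborel \<phi>" and ?f = "L2_norm lborel f"
  define S where "S = (\<Sum>k\<in>I. (L2_norm lborel (G k))\<^sup>2)"
  note G = norm_synthesis_restricted_stft_le[OF g f A, folded G_def]
  have h: "?h k \<in> L2 lborel" if "k \<in> I" for k
    by (rule synthesis_L2[OF G(1)[OF that] g])
  have H: "?H \<in> L2 lborel" by (rule L2_sum[OF h])
  have S_eq: "(L2_norm lborel (\<lambda>z. stft g f z * indicator (\<Union>k\<in>I. A k) z))\<^sup>2 = S"
  proof -
    have "(cmod (stft g f z * indicator (\<Union>k\<in>I. A k) z))\<^sup>2 = (\<Sum>k\<in>I. (cmod (G k z))\<^sup>2)" for z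
    proof (cases "\<exists>k\<in>I. z \<in> A k")
      case True
      then obtain k where k: "k \<in> I" "z \<in> A k" by blast
      then have "z \<notin> A l" if "l \<in> I - {k}" for l
        using disj that by (auto simp: disjoint_family_on_def)
      then have "(\<Sum>l\<in>I. (cmod (G l z))\<^sup>2) = (cmod (G k z))\<^sup>2"
        using I k by (simp add: sum.remove[OF I k(1)] G_def)
      then show ?thesis using k by (auto simp: G_def indicator_def)
    qed (auto simp: G_def)
    then show ?thesis
      unfolding L2_norm_square S_def using G(2)
      by (simp add: L2_def Bochner_Integration.integral_sum)
  qed
  have S0: "0 \<le> S" by (simp add: S_def sum_nonneg)
  have "L2_inner lborel ?H f = (\<Sum>k\<in>I. L2_inner lborel (?h k) f)"
    by (rule L2_inner_sum_left[OF h f])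
  also have "\<dots> = of_real S"
    unfolding S_def of_real_sum by (intro sum.cong refl G(4))
  finally have "S = cmod (L2_inner lborel ?H f)"
    using S0 by simp
  also have "\<dots> \<le> L2_norm lborel ?H * ?f"
    by (rule L2_Cauchy_Schwarz[OF H f])
  finally have "S\<^sup>2 \<le> (L2_norm lborel ?H * ?f)\<^sup>2"
    using S0 by (rule power_mono)
  then have "S * S \<le> (L2_norm lborel ?H)\<^sup>2 * ?f\<^sup>2"
    by (simp only: power_mult_distrib power2_eq_square[of S])
  then have 1: "(?\<phi>\<^sup>2 * S) * S \<le> (?\<phi>\<^sup>2 * (L2_norm lborel ?H)\<^sup>2) * ?f\<^sup>2"
    using pos(2) by (simp add: mult.assoc)
  have "?\<phi>\<^sup>2 * (L2_norm lborel ?H)\<^sup>2 \<le> (\<Sum>k\<in>I. ?\<phi>\<^sup>2 * (L2_norm lborel (?h k))\<^sup>2) + real (card I) * T * S"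
    unfolding S_def
  proof (rule norm_sum_synthesis_le[OF I g \<phi> G(1,2) _ tail T])
    fix k l z w assume "k \<in> I" "l \<in> I" "k \<noteq> l" "G k z \<noteq> 0" "G l w \<noteq> 0"
    then show "r \<le> dist z w"
      by (intro sep[of k l]) (auto simp: G_def indicator_def split: if_splits)
  qed
  also have "(\<Sum>k\<in>I. ?\<phi>\<^sup>2 * (L2_norm lborel (?h k))\<^sup>2) \<le> (\<Sum>k\<in>I. ?\<phi>\<^sup>2 * (c * ?g * L2_norm lborel (G k))\<^sup>2)"
  proof (intro sum_mono mult_left_mono power_mono)
    fix k assume k: "k \<in> I"
    have "L2_norm lborel (?h k) \<le> concentration g (A k) * ?g * L2_norm lborel (G k)"
      by (rule G(3)[OF k])
    also have "\<dots> \<le> c * ?g * L2_norm lborel (G k)"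
      by (intro mult_right_mono c k) auto
    finally show "L2_norm lborel (?h k) \<le> c * ?g * L2_norm lborel (G k)" .
  qed auto
  also have "\<dots> = ?\<phi>\<^sup>2 * c\<^sup>2 * ?g\<^sup>2 * S"
    by (simp add: S_def sum_distrib_left power_mult_distrib mult_ac)
  also have "\<dots> + real (card I) * T * S = (?\<phi>\<^sup>2 * S) * (?b * ?g\<^sup>2)"
    using pos by (simp add: field_simps power_mult_distrib)
  finally have 2: "?\<phi>\<^sup>2 * (L2_norm lborel ?H)\<^sup>2 \<le> (?\<phi>\<^sup>2 * S) * (?b * ?g\<^sup>2)" by simp
  have 3: "(?\<phi>\<^sup>2 * S) * S \<le> (?\<phi>\<^sup>2 * S) * (?b * ?g\<^sup>2 * ?f\<^sup>2)"
    using order_trans[OF 1 mult_right_mono[OF 2]] by (simp add: mult.assoc)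
  have "S \<le> ?b * ?g\<^sup>2 * ?f\<^sup>2"
  proof (cases "S = 0")
    case True
    then show ?thesis using b0 by simp
  next
    case False
    then have "0 < ?\<phi>\<^sup>2 * S" using S0 pos by simp
    with 3 show ?thesis by (simp only: mult_le_cancel_left_pos)
  qed
  then have "sqrt S \<le> sqrt (?b * ?g\<^sup>2 * ?f\<^sup>2)" by (rule real_sqrt_le_mono)
  also have "\<dots> = sqrt ?b * (?g * ?f)" by (simp only: real_sqrt_mult real_sqrt_abs abs_of_nonneg L2_norm_nonneg mult.assoc)
  also have "sqrt S = L2_norm lborel (\<lambda>z. stft g f z * indicator (\<Union>k\<in>I. A k) z)"
    unfolding S_eq[symmetric] by simp
  finally show "L2_norm lborel (\<lambda>z. stft g f z * indicator (\<Union>k\<in>I. A k) z) \<le> sqrt ?b * L2_norm lborel (stft g f)"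
    by (simp only: moyal[OF f g] mult_ac)
qed

text \<open>The square of the Gaussian window is the density of the normal distribution with variance \<open>1 / (4 \<pi>)\<close>.\<close>

lemma gaussian_L2: "gaussian \<in> L2 lborel"
  and gaussian_norm_pos: "0 < L2_norm lborel gaussian"
proof -
  have sq: "(cmod (gaussian t))\<^sup>2 = normal_density 0 (1 / (2 * sqrt pi)) t" for t
  proof -
    have "(2 powr (1/4 :: real))\<^sup>2 = sqrt 2"
      by (simp add: powr_power powr_half_sqrt)
    then show ?thesis
      by (simp add: gaussian_def normal_density_def norm_mult power_mult_distrib real_sqrt_mult real_sqrt_divide
          power_divide field_simps flip: exp_double)
  qed
  have "gaussian \<in> borel_measurable lborel"
    unfolding gaussian_def[abs_def] by measurable
  then show "gaussian \<in> L2 lborel"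
    by (simp add: L2_def sq)
  show "0 < L2_norm lborel gaussian"
    by (simp add: L2_norm_def sq)
qed

theorem proposition8:
  fixes g :: "real \<Rightarrow> complex" and N :: nat
    and \<Delta> :: "'i \<Rightarrow> nat \<Rightarrow> (real \<times> real) set" and F :: "'i filter"
  assumes "g \<in> M1"
    and "N \<ge> 1"
    and "\<And>i k. k \<in> {1..N} \<Longrightarrow> compact (\<Delta> i k)"
    and "\<And>i. disjoint_family_on (\<Delta> i) {1..N}"
    and "((\<lambda>i. separation N (\<Delta> i)) \<longlongrightarrow> \<infinity>) F"
  shows "((\<lambda>i. concentration g (\<Union>k\<in>{1..N}. \<Delta> i k) -
                (MAX k\<in>{1..N}. concentration g (\<Delta> i k))) \<longlongrightarrow> 0) F"
proof -
  let ?I = "{1..N}"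
  define U where "U = (\<lambda>i. concentration g (\<Union>k\<in>?I. \<Delta> i k))"
  define C where "C = (\<lambda>i. MAX k\<in>?I. concentration g (\<Delta> i k))"
  have g: "g \<in> L2 lborel" and Vg: "integrable lborel (stft gaussian g)"
    using assms(1) by (auto simp: M1_def)
  have I: "finite ?I" "?I \<noteq> {}" using assms(2) by auto
  have meas: "\<Delta> i k \<in> fmeasurable lborel" "\<Delta> i k \<in> sets borel" if "k \<in> ?I" for i k
    using assms(3)[OF that] by (auto intro: fmeasurable_compact borel_compact)
  have measU: "(\<Union>k\<in>?I. \<Delta> i k) \<in> sets borel" for i
    using meas(2) by (intro sets.finite_UN) auto
  have C_upper: "concentration g (\<Delta> i k) \<le> C i" if "k \<in> ?I" for i k
    unfolding C_def using I that by (intro Max_ge) auto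
  have C0: "0 \<le> C i" for i
    using concentration_nonneg[OF g meas(2), of 1 i] C_upper[of 1 i] assms(2) by simp
  have CU: "C i \<le> U i" for i
    unfolding C_def U_def using I by (intro Max.boundedI) (auto intro!: concentration_mono g meas(2) measU)
  have "\<forall>\<^sub>F i in F. \<bar>U i - C i\<bar> < e" if e: "0 < e" for e
  proof (cases "L2_norm lborel g = 0")
    case True
    \<comment> \<open>All transforms have norm \<open>0\<close>, and so all concentrations vanish.\<close>
    have "U i \<le> 0" for i
      unfolding U_def
    proof (rule concentration_least)
      fix f :: "real \<Rightarrow> complex" assume f: "f \<in> L2 lborel"
      show "L2_norm lborel (\<lambda>z. stft g f z * indicator (\<Union>k\<in>?I. \<Delta> i k) z) \<le> 0 * L2_norm lborel (stft g f)"
        using L2_norm_restrict_le[OF stft_L2[OF f g], of "\<Union>k\<in>?I. \<Delta> i k"] measU moyal[OF f g] True by simp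
    qed simp
    then have "U i = C i" for i using C0[of i] CU[of i] by (metis order_antisym order_trans)
    then show ?thesis using e by simp
  next
    case False
    define p where "p = (L2_norm lborel g * L2_norm lborel gaussian)\<^sup>2"
    have pos: "0 < L2_norm lborel g" using False L2_norm_nonneg[of lborel g] by linarith
    then have p: "0 < p" using gaussian_norm_pos by (simp add: p_def)
    let ?m = "\<lambda>v. ennreal (cmod (stft gaussian g v))"
    \<comment> \<open>The choice of \<open>T\<close> turns the error term of the estimate for unions into \<open>(e / 2)\<^sup>2\<close>.\<close>
    define T where "T = (e / 2)\<^sup>2 * p / real N"
    have T: "0 < T" using e p assms(2) by (simp add: T_def)
    have [measurable]: "?m \<in> borel_measurable borel" using Vg by (auto dest: borel_measurable_integrable)
    have "(\<lambda>n. tail_correlation ?m (real n)) \<longlonglongrightarrow> 0"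
      using Vg by (intro tail_correlation_tendsto_0) (auto simp: integrable_iff_bounded)
    then have "\<forall>\<^sub>F n in sequentially. tail_correlation ?m (real n) < ennreal T"
      using T by (simp add: tendsto_ennreal_0_iff)
    then obtain n :: nat where n: "tail_correlation ?m (real n) < ennreal T"
      by (auto simp: eventually_sequentially)
    have "\<forall>\<^sub>F i in F. ereal (real n) < separation N (\<Delta> i)"
      using assms(5) by (rule order_tendstoD) simp
    then show ?thesis
    proof eventually_elim
      case (elim i)
      have sep: "real n \<le> dist z w" if "k \<in> ?I" "l \<in> ?I" "k \<noteq> l" "z \<in> \<Delta> i k" "w \<in> \<Delta> i l" for k l z w
      proof -
        have "separation N (\<Delta> i) \<le> set_distance (\<Delta> i k) (\<Delta> i l)"
          unfolding separation_def using that by (intro INF_lower2[of "(k, l)"]) auto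
        also have "\<dots> \<le> ereal (dist z w)"
          unfolding set_distance_def using that by (intro INF_lower2[of z] INF_lower2[of w]) auto
        finally have "ereal (real n) < ereal (dist z w)" using elim by (rule less_le_trans[rotated])
        then show ?thesis by simp
      qed
      have "U i \<le> sqrt ((C i)\<^sup>2 + real (card ?I) * T / p)"
        unfolding U_def p_def
        by (rule concentration_separated_UN_le[OF I(1) g gaussian_L2 pos gaussian_norm_pos meas(1) assms(4) sep
              less_imp_le[OF n] less_imp_le[OF T] C_upper C0])
      also have "real (card ?I) * T / p = (e / 2)\<^sup>2"
        using p assms(2) by (simp add: T_def)
      also have "sqrt ((C i)\<^sup>2 + (e / 2)\<^sup>2) \<le> C i + e / 2"
        using C0 e by (intro sqrt_sum_squares_le_sum) auto
      finally show "\<bar>U i - C i\<bar> < e" using CU[of i] e by simp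
    qed
  qed
  then have "((\<lambda>i. U i - C i) \<longlongrightarrow> 0) F"
    by (simp add: tendsto_iff)
  then show ?thesis by (simp only: U_def C_def)
qed

end
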